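(* Let $p$ be a prime and $d,m,n$ positive integers; write $n=am+b$ with $a\in\mathbb{N}$ and $0\le b\le m-1$. Let $R$ be a finite local ring of order $p^{dn}$ whose maximal ideal $I$ is generated by $\pi$, with $\pi^{n-1}\neq0$, $\pi^n=0$, $p=\pi^m u$ for a unit $u$, and $R/I$ a field of order $p^d$. Let $R_1\subseteq R$ be a set of coset representatives of $I$ in $R$ with $0\in R_1$, $R_0=\{0\}$ and $R_i=R_1+\pi R_1+\cdots+\pi^{i-1}R_1$ for $1\le i\le n$. Let $h$ be a positive integer with distinct prime divisors $p_1,\dots,p_r$. Assume that one of the following holds: (i) $p^d\in p_1\mathbb{N}+\cdots+p_r\mathbb{N}$; (ii) there exist complex $h$th roots of unity $\eta$, $\eta_r$ ($r\in R$), $\delta_u$ ($u\in R_{n-1}$), $\mu_s$ ($s\in I$), $\gamma_v$ ($v\in\pi R_{n-2}$) such that for all $1\le i\le n-1$ and $0\le j\le n-2$: $\sum_{r\in u+I^i}\eta_r=\delta_u$ for all $u\in R_i$; $\sum_{s\in v+I^{j+1}}\mu_s=\gamma_v$ for all $v\in\pi R_j$; and $\sum_{u\in R_1}\delta_u+\sum_{v\in\pi R_1}\gamma_v=\eta$. Then there exists a perfect $h$-phase array of size $p^{a+1}\times\cdots\times p^{a+1}\times p^a\times\cdots\times p^a$, with $2db$ factors $p^{a+1}$ and $2d(m-b)$ factors $p^a$.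
   Context: $\mathbb{N}=\{0,1,2,\dots\}$; $p_1\mathbb{N}+\cdots+p_r\mathbb{N}$ is the set of sums $\sum_i p_ia_i$ with $a_i\in\mathbb{N}$. $I^j$ denotes the $j$th power of the ideal $I$. A $k$-dimensional array $A=(a_{i_1,\dots,i_k})$ of size $n_1\times\cdots\times n_k$ is a perfect $h$-phase array if all entries are complex $h$th roots of unity and $\sum_{0\le i_j\le n_j-1\ \forall j} a_{i_1,\dots,i_k}\overline{a_{i_1+s_1,\dots,i_k+s_k}}=0$ for every $(s_1,\dots,s_k)\neq(0,\dots,0)$, indices taken modulo $n_j$.
   Formalization: In the last equation of (ii), γ_v (v ∈ πR_1) is not defined for n ≤ 2 and δ_u (u ∈ R_1) is not defined for n = 1; there they are replaced by the singleton coset sums μ_v and η_u. For n ≥ 3 condition (ii) is as printed. *)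

theory Defs
  imports
    Complex_Main
    "HOL-Algebra.Algebra"
    "HOL-Computational_Algebra.Primes"
begin

text \<open>As usual, local rings are commutative.\<close>

definition local_ring :: "('a, 'b) ring_scheme \<Rightarrow> bool" where
  "local_ring R \<longleftrightarrow> cring R \<and> (\<exists>!I. maximalideal I R)"

abbreviation ideal_power :: "('a, 'b) ring_scheme \<Rightarrow> 'a set \<Rightarrow> nat \<Rightarrow> 'a set" where
  "ideal_power R I j \<equiv> I [^]\<^bsub>ideals_set R\<^esub> j"

definition coset_representatives :: "('a, 'b) ring_scheme \<Rightarrow> 'a set \<Rightarrow> 'a set \<Rightarrow> bool" where
  "coset_representatives R I T \<longleftrightarrow>
     T \<subseteq> carrier R \<and> (\<forall>C \<in> a_rcosets\<^bsub>R\<^esub> I. \<exists>!x. x \<in> T \<and> x \<in> C)"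

text \<open>
  For a set \<open>T\<close> of representatives of the residue field, \<open>digit_set R \<pi> T i\<close> is the set
  \<open>T + \<pi> T + \<dots> + \<pi>^(i - 1) T\<close>, and \<open>{0}\<close> if \<open>i = 0\<close>.
\<close>

primrec digit_set :: "('a, 'b) ring_scheme \<Rightarrow> 'a \<Rightarrow> 'a set \<Rightarrow> nat \<Rightarrow> 'a set" where
  "digit_set R \<pi> T 0 = {\<zero>\<^bsub>R\<^esub>}"
| "digit_set R \<pi> T (Suc i) = digit_set R \<pi> T i <+>\<^bsub>R\<^esub> ((\<pi> [^]\<^bsub>R\<^esub> i) <#\<^bsub>R\<^esub> T)"

text \<open>
  An array of size \<open>n\<^sub>1 \<times> \<dots> \<times> n\<^sub>k\<close> is a function on index lists \<open>[i\<^sub>1, \<dots>, i\<^sub>k]\<close>; only its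
  values at indices with \<open>0 \<le> i\<^sub>j < n\<^sub>j\<close> matter. Shifts are residues modulo the
  \<open>n\<^sub>j\<close>, so they range over the same set of lists.
\<close>

definition array_indices :: "nat list \<Rightarrow> nat list set" where
  "array_indices ns = {is. length is = length ns \<and> (\<forall>j < length ns. is ! j < ns ! j)}"

definition shift_index :: "nat list \<Rightarrow> nat list \<Rightarrow> nat list \<Rightarrow> nat list" where
  "shift_index ns is ss = map (\<lambda>j. (is ! j + ss ! j) mod ns ! j) [0..<length ns]"

definition perfect_phase_array :: "nat \<Rightarrow> nat list \<Rightarrow> (nat list \<Rightarrow> complex) \<Rightarrow> bool" where
  "perfect_phase_array h ns A \<longleftrightarrow>
     (\<forall>is \<in> array_indices ns. A is ^ h = 1) \<and>
     (\<forall>ss \<in> array_indices ns. ss \<noteq> replicate (length ns) 0 \<longrightarrow>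
        (\<Sum>is \<in> array_indices ns. A is * cnj (A (shift_index ns is ss))) = 0)"

text \<open>
  The condition on the existence of roots of unity. The indices \<open>1 \<le> i \<le> n - 1\<close> and
  \<open>0 \<le> j \<le> n - 2\<close> are integers, so for \<open>n = 1\<close> there are none; this is why the ranges are
  written \<open>1 \<le> i \<and> i < n\<close> and \<open>j + 1 < n\<close> instead of using truncated subtraction.

  In the last equation, \<open>\<delta>\<close> on \<open>T\<close> and \<open>\<gamma>\<close> on \<open>\<pi> T\<close> are the sums of \<open>\<epsilon>\<close> over the cosets of
  \<open>I\<close> and of \<open>\<mu>\<close> over the cosets of \<open>I\<^sup>2\<close> in \<open>I\<close>. They are among the given numbers if
  \<open>n \<ge> 2\<close> and \<open>n \<ge> 3\<close>, respectively. For \<open>n = 1\<close> (so \<open>I = 0\<close>), resp. \<open>n \<le> 2\<close>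
  (so \<open>I\<^sup>2 = 0\<close>), these cosets are singletons and the sums are the values of \<open>\<epsilon>\<close>,
  resp. \<open>\<mu>\<close>, themselves.
\<close>

definition root_system ::
  "('a, 'b) ring_scheme \<Rightarrow> 'a set \<Rightarrow> 'a \<Rightarrow> 'a set \<Rightarrow> nat \<Rightarrow> nat \<Rightarrow> complex \<Rightarrow>
   ('a \<Rightarrow> complex) \<Rightarrow> ('a \<Rightarrow> complex) \<Rightarrow> ('a \<Rightarrow> complex) \<Rightarrow> ('a \<Rightarrow> complex) \<Rightarrow> bool" where
  "root_system R I \<pi> T n h \<eta> \<epsilon> \<delta> \<mu> \<gamma> \<longleftrightarrow>
     \<eta> ^ h = 1 \<and>
     (\<forall>r \<in> carrier R. \<epsilon> r ^ h = 1) \<and>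
     (\<forall>u \<in> digit_set R \<pi> T (n - 1). \<delta> u ^ h = 1) \<and>
     (\<forall>s \<in> I. \<mu> s ^ h = 1) \<and>
     (\<forall>v \<in> \<pi> <#\<^bsub>R\<^esub> digit_set R \<pi> T (n - 2). \<gamma> v ^ h = 1) \<and>
     (\<forall>i. 1 \<le> i \<and> i < n \<longrightarrow>
        (\<forall>u \<in> digit_set R \<pi> T i. (\<Sum>r \<in> u <+\<^bsub>R\<^esub> ideal_power R I i. \<epsilon> r) = \<delta> u)) \<and>
     (\<forall>j. j + 1 < n \<longrightarrow>
        (\<forall>v \<in> \<pi> <#\<^bsub>R\<^esub> digit_set R \<pi> T j.
           (\<Sum>s \<in> v <+\<^bsub>R\<^esub> ideal_power R I (j + 1). \<mu> s) = \<gamma> v)) \<and>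
     (\<Sum>u \<in> T. if 2 \<le> n then \<delta> u else \<epsilon> u) +
       (\<Sum>v \<in> \<pi> <#\<^bsub>R\<^esub> T. if 3 \<le> n then \<gamma> v else \<mu> v) = \<eta>"

end

theory Submission
  imports Defs
begin

text \<open>
  Equip \<open>R\<^sup>2\<close> with the symplectic form \<open>x y' - y x'\<close>, and let \<open>\<chi>\<close> be an additive character of \<open>R\<close> that
  is nontrivial on the socle \<open>\<pi>^(n - 1) R\<close>. The indicator function of a submodule of \<open>R\<^sup>2\<close> which equals its own
  orthogonal complement is, up to the factor \<open>card R\<close>, its own Fourier transform with respect to
  \<open>\<chi>\<close> and the form; hence so is every linear combination \<open>F\<close> of such indicator functions. If moreover
  all values of \<open>F\<close> have modulus one, then the autocorrelation of \<open>F\<close> at \<open>s \<noteq> 0\<close> is a sum of a nontrivial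
  character and vanishes.

  Under (ii) one takes the free lines through the points \<open>(1, r)\<close> and \<open>(s, 1)\<close>, with \<open>s \<in> I\<close>, weighted by \<open>\<epsilon>\<close>
  and \<open>\<mu>\<close>: the lines through \<open>\<pi>^k (1, r)\<close> are those whose slope is congruent to \<open>r\<close> modulo \<open>\<pi>^(n - k)\<close>, so the
  values of \<open>F\<close> are the sums occurring in (ii). Under (i) there are \<open>p^d\<close> roots of unity with sum zero, and
  one uses the self-dual modules \<open>\<pi>^k L + \<pi>^(n - k) R\<^sup>2\<close>, for lines \<open>L\<close> and \<open>k \<le> n / 2\<close>, with weights chosen such that,
  except at the last level, the modules of level \<open>k\<close> contribute only to the vectors in \<open>\<pi>^k R\<^sup>2\<close> outside
  \<open>\<pi>^(k + 1) R\<^sup>2\<close>.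

  The additive group of \<open>R\<close> is a direct sum of the cyclic groups generated by \<open>\<pi>^i e\<^sub>j\<close>, with \<open>i < m\<close> and \<open>j < d\<close>,
  where the \<open>e\<^sub>j\<close> generate \<open>R\<close> modulo \<open>I\<close>: these elements generate \<open>R\<close>, and the product of the bounds
  \<open>p^(a + 1)\<close> or \<open>p^a\<close> for their orders is \<open>card R\<close>. The decomposition also supplies \<open>\<chi>\<close>.
\<close>

section \<open>Cyclic decompositions and roots of unity\<close>

text \<open>By Lagrange all subgroups have \<open>p\<close>-power order, so adjoining an element
  outside \<open>H\<close> multiplies the order by at least \<open>p\<close>; after \<open>d\<close>
  adjunctions the bound on the index is used up. Applied to the ideal \<open>P 1\<close>, this
  yields the elements called \<open>es\<close> below.\<close>

lemma (in group) generators_over_subgroup: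
  assumes "finite (carrier G)" "order G = p ^ N" "Factorial_Ring.prime (p::nat)" "subgroup H G" "order G \<le> p ^ d * card H"
  shows "\<exists>es. length es = d \<and> set es \<subseteq> carrier G \<and>
    (\<forall>S. subgroup S G \<longrightarrow> H \<subseteq> S \<longrightarrow> set es \<subseteq> S \<longrightarrow> S = carrier G)"
  using assms(4,5)
proof (induct d arbitrary: H)
  case 0
  then have "H = carrier G"
    using card_seteq[OF assms(1) subgroup.subset[OF 0(1)]] by (simp add: order_def)
  then show ?case using subgroup.subset by (intro exI[of _ "[]"]) fastforce
next
  case (Suc d)
  have fin: "finite K" if "subgroup K G" for K
    using finite_subset[OF subgroup.subset[OF that] assms(1)] .
  show ?case
  proof (cases "H = carrier G")
    case True
    \<comment> \<open>Identities pad the list: its length must be exactly \<open>d\<close>, since it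
      enters the shape of the array.\<close>
    then show ?thesis using subgroup.subset
      by (intro exI[of _ "replicate (Suc d) \<one>"]) fastforce
  next
    case False
    then obtain x where x: "x \<in> carrier G" "x \<notin> H" using subgroup.subset[OF Suc(2)] by auto
    define H' where "H' = generate G (insert x H)"
    have sub: "insert x H \<subseteq> carrier G" using x subgroup.subset[OF Suc(2)] by auto
    have H': "subgroup H' G" using generate_is_subgroup[OF sub] by (simp add: H'_def)
    have "insert x H \<subseteq> H'" unfolding H'_def using generate.incl[of _ "insert x H" G] by blast
    then have less: "card H < card H'" using x fin[OF H'] by (intro psubset_card_mono) auto
    obtain i where i: "card H = p ^ i"
      using lagrange[OF Suc(2)] assms(2) divides_primepow_nat[OF assms(3)] by (metis dvd_triv_right)
    obtain j where j: "card H' = p ^ j"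
      using lagrange[OF H'] assms(2) divides_primepow_nat[OF assms(3)] by (metis dvd_triv_right)
    have "Suc i \<le> j" using less prime_gt_1_nat[OF assms(3)] unfolding i j by simp
    then have "p ^ Suc i \<le> p ^ j" using prime_gt_1_nat[OF assms(3)] by (intro power_increasing) auto
    then have "p ^ d * p ^ Suc i \<le> p ^ d * card H'" unfolding j by (rule mult_left_mono) simp
    moreover have "order G \<le> p ^ d * p ^ Suc i" using Suc(3) unfolding i by (simp add: mult_ac)
    ultimately have "order G \<le> p ^ d * card H'" by linarith
    then obtain es where es: "length es = d" "set es \<subseteq> carrier G"
      "\<And>S. subgroup S G \<Longrightarrow> H' \<subseteq> S \<Longrightarrow> set es \<subseteq> S \<Longrightarrow> S = carrier G"
      using Suc(1)[OF H'] by blast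
    show ?thesis
    proof (intro exI[of _ "x # es"] conjI allI impI)
      fix S assume S: "subgroup S G" "H \<subseteq> S" "set (x # es) \<subseteq> S"
      then have "H' \<subseteq> S" unfolding H'_def by (intro generate_subgroup_incl) auto
      then show "S = carrier G" using es(3) S by simp
    qed (use es x in auto)
  qed
qed

section \<open>Arrays as functions on a direct sum of cyclic groups\<close>

lemma card_array_indices: "card (array_indices ns) = prod_list ns" "finite (array_indices ns)"
proof (induct ns)
  case Nil
  { case 1 show ?case by (simp add: array_indices_def) next case 2 show ?case by (simp add: array_indices_def) }
next
  case (Cons n ns)
  have eq: "array_indices (n # ns) = (\<lambda>(i, is). i # is) ` ({..<n} \<times> array_indices ns)"
  proof (intro equalityI subsetI)
    fix xs assume "xs \<in> array_indices (n # ns)"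
    then obtain i "is" where "xs = i # is" "i < n" "is \<in> array_indices ns"
      unfolding array_indices_def by (cases xs) fastforce+
    then show "xs \<in> (\<lambda>(i, is). i # is) ` ({..<n} \<times> array_indices ns)" by auto
  qed (auto simp: array_indices_def nth_Cons split: nat.splits)
  have "inj_on (\<lambda>(i, is). i # is) ({..<n} \<times> array_indices ns)" by (auto simp: inj_on_def)
  { case 1 then show ?case using Cons \<open>inj_on _ _\<close> by (simp add: eq card_image)
  next case 2 then show ?case using Cons by (simp add: eq) }
qed

lemma replicate_in_array_indices: "(\<And>j. j < length ns \<Longrightarrow> 0 < ns ! j) \<Longrightarrow> replicate (length ns) 0 \<in> array_indices ns"
  by (simp add: array_indices_def)

lemma shift_in_array_indices: "(\<And>j. j < length ns \<Longrightarrow> 0 < ns ! j) \<Longrightarrow> shift_index ns is ss \<in> array_indices ns"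
  by (simp add: array_indices_def shift_index_def)

text \<open>The \<open>ns\<close> are asked to kill the generators, not to be their exact orders:
  generation makes the map from index lists to the group surjective, and \<open>order_eq\<close>
  then forces injectivity, so directness comes from counting.\<close>

locale cyclic_decomposition = comm_group G for G (structure) +
  fixes gs :: "'a list" and ns :: "nat list"
  assumes finite_group: "finite (carrier G)"
    and gs_closed: "set gs \<subseteq> carrier G"
    and length_eq: "length gs = length ns"
    and pos: "j < length ns \<Longrightarrow> 0 < ns ! j"
    and torsion: "j < length ns \<Longrightarrow> gs ! j [^] (ns ! j) = \<one>"
    and generating: "subgroup S G \<Longrightarrow> set gs \<subseteq> S \<Longrightarrow> S = carrier G"
    and order_eq: "order G = prod_list ns"
begin

text \<open>Exponents are not reduced modulo \<open>ns\<close>, so that products of combinations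
  correspond to plain sums of exponents.\<close>

definition comb :: "(nat \<Rightarrow> nat) \<Rightarrow> 'a" where
  "comb c = finprod G (\<lambda>j. gs ! j [^] c j) {..<length ns}"

lemma gs_nth [simp]: "j < length ns \<Longrightarrow> gs ! j \<in> carrier G"
  using gs_closed length_eq nth_mem by (metis subsetD)

lemma comb_closed [simp]: "comb c \<in> carrier G"
  unfolding comb_def by (rule finprod_closed) auto

lemma comb_cong: "(\<And>j. j < length ns \<Longrightarrow> gs ! j [^] c j = gs ! j [^] c' j) \<Longrightarrow> comb c = comb c'"
  unfolding comb_def by (rule finprod_cong') auto

lemma comb_add: "comb (\<lambda>j. c j + c' j) = comb c \<otimes> comb c'"
proof -
  have "comb c \<otimes> comb c' = finprod G (\<lambda>j. gs ! j [^] c j \<otimes> gs ! j [^] c' j) {..<length ns}"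
    unfolding comb_def by (rule finprod_multf[symmetric]) auto
  also have "\<dots> = comb (\<lambda>j. c j + c' j)"
    unfolding comb_def by (rule finprod_cong') (auto simp: nat_pow_mult)
  finally show ?thesis by simp
qed

lemma comb_zero: "comb (\<lambda>_. 0) = \<one>"
  unfolding comb_def by simp

lemma pow_multiple: "j < length ns \<Longrightarrow> gs ! j [^] (ns ! j * k) = \<one>"
  by (simp add: nat_pow_pow[symmetric] torsion)

lemma pow_mod: "j < length ns \<Longrightarrow> gs ! j [^] (k mod ns ! j) = gs ! j [^] k"
proof -
  assume j: "j < length ns"
  have "gs ! j [^] k = gs ! j [^] (ns ! j * (k div ns ! j) + k mod ns ! j)" by simp
  also have "\<dots> = gs ! j [^] (k mod ns ! j)"
    using j by (simp only: nat_pow_mult[symmetric] gs_nth) (simp add: pow_multiple)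
  finally show ?thesis by simp
qed

lemma range_comb: "range comb = carrier G"
proof (rule generating)
  show "subgroup (range comb) G"
  proof (rule subgroupI)
    show "inv x \<in> range comb" if "x \<in> range comb" for x
    proof -
      obtain c where c: "x = comb c" using \<open>x \<in> range comb\<close> by auto
      \<comment> \<open>Natural exponents have no negatives; \<open>(ns ! j - 1) * c j\<close>
        stands in for the negative of \<open>c j\<close>, as the two add up to a multiple of
        \<open>ns ! j\<close>.\<close>
      have "comb (\<lambda>j. (ns ! j - 1) * c j) \<otimes> comb c = comb (\<lambda>j. (ns ! j - 1) * c j + c j)" by (simp add: comb_add)
      also have "\<dots> = comb (\<lambda>_. 0)"
      proof (rule comb_cong)
        fix j assume j: "j < length ns"
        have "(ns ! j - 1) * c j + c j = ns ! j * c j" using pos[OF j] by (cases "ns ! j") auto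
        then show "gs ! j [^] ((ns ! j - 1) * c j + c j) = gs ! j [^] (0::nat)" using pow_multiple[OF j] by simp
      qed
      finally have "inv x = comb (\<lambda>j. (ns ! j - 1) * c j)" unfolding c by (intro inv_equality) (simp_all add: comb_zero)
      then show ?thesis by blast
    qed
  next
    show "x \<otimes> y \<in> range comb" if "x \<in> range comb" "y \<in> range comb" for x y
    proof -
      obtain c c' where "x = comb c" "y = comb c'" using \<open>x \<in> range comb\<close> \<open>y \<in> range comb\<close> by auto
      then have "x \<otimes> y = comb (\<lambda>j. c j + c' j)" by (simp add: comb_add)
      then show ?thesis by blast
    qed
  qed auto
next
  show "set gs \<subseteq> range comb"
  proof
    fix g assume "g \<in> set gs"
    then obtain i where i: "i < length ns" "g = gs ! i" using length_eq by (auto simp: in_set_conv_nth)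
    have "comb (\<lambda>j. if i = j then 1 else 0) = finprod G (\<lambda>j. if i = j then gs ! j else \<one>) {..<length ns}"
      unfolding comb_def using i by (intro finprod_cong') auto
    also have "\<dots> = g" using i finprod_singleton[of i "{..<length ns}" "\<lambda>j. gs ! j"] by auto
    finally show "g \<in> range comb" by blast
  qed
qed

definition elem :: "nat list \<Rightarrow> 'a" where "elem is = comb (\<lambda>j. is ! j)"

lemma elem_closed [simp]: "elem is \<in> carrier G"
  by (simp add: elem_def)

text \<open>Cyclic shifts of index lists become translations in the group; this turns
  autocorrelations of arrays into autocorrelations of functions.\<close>

lemma elem_shift: "elem (shift_index ns is ss) = elem is \<otimes> elem ss"
proof -
  have "elem (shift_index ns is ss) = comb (\<lambda>j. is ! j + ss ! j)"
    unfolding elem_def shift_index_def by (rule comb_cong) (simp add: pow_mod)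
  then show ?thesis by (simp add: elem_def comb_add)
qed

lemma elem_zero: "elem (replicate (length ns) 0) = \<one>"
proof -
  have "elem (replicate (length ns) 0) = comb (\<lambda>_. 0)" unfolding elem_def by (rule comb_cong) simp
  then show ?thesis by (simp add: comb_zero)
qed

lemma bij_elem: "bij_betw elem (array_indices ns) (carrier G)"
proof -
  have "elem ` array_indices ns = carrier G"
  proof (intro equalityI subsetI)
    fix x assume "x \<in> carrier G"
    then obtain c where c: "x = comb c" using range_comb by auto
    define "is" where "is = map (\<lambda>j. c j mod ns ! j) [0..<length ns]"
    have "elem is = x" unfolding c elem_def is_def by (rule comb_cong) (simp add: pow_mod)
    moreover have "is \<in> array_indices ns" using pos by (simp add: array_indices_def is_def)
    ultimately show "x \<in> elem ` array_indices ns" by blast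
  qed auto
  then show ?thesis
    using card_array_indices[of ns] order_eq by (simp add: bij_betw_def eq_card_imp_inj_on order_def)
qed

text \<open>Some coordinate of \<open>s\<close> is nonzero, and a faithful character of the
  corresponding cyclic factor detects it.\<close>

lemma nontrivial_character:
  assumes s: "s \<in> carrier G" "s \<noteq> \<one>"
  shows "\<exists>\<psi> :: 'a \<Rightarrow> complex. (\<forall>x \<in> carrier G. \<forall>y \<in> carrier G. \<psi> (x \<otimes> y) = \<psi> x * \<psi> y) \<and>
    (\<forall>x. norm (\<psi> x) = 1) \<and> \<psi> s \<noteq> 1"
proof -
  define \<iota> where "\<iota> = inv_into (array_indices ns) elem"
  have iota: "\<iota> x \<in> array_indices ns" "elem (\<iota> x) = x" if "x \<in> carrier G" for x
    using that bij_elem unfolding \<iota>_def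
    by (metis bij_betw_imp_surj_on inv_into_into, metis bij_betw_imp_surj_on f_inv_into_f)
  have iota_elem: "\<iota> (elem is) = is" if "is \<in> array_indices ns" for "is"
    using that bij_elem unfolding \<iota>_def by (metis bij_betw_imp_inj_on inv_into_f_f)
  have iota_mult: "\<iota> (x \<otimes> y) = shift_index ns (\<iota> x) (\<iota> y)" if "x \<in> carrier G" "y \<in> carrier G" for x y
    using iota_elem[of "shift_index ns (\<iota> x) (\<iota> y)"] shift_in_array_indices[of ns] pos that iota
    by (simp add: elem_shift)
  have "\<iota> s \<noteq> replicate (length ns) 0" using iota(2)[OF s(1)] elem_zero s(2) by metis
  then obtain i where i: "i < length ns" "\<iota> s ! i \<noteq> 0"
    using iota(1)[OF s(1)] by (auto simp: array_indices_def list_eq_iff_nth_eq)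
  define N where "N = ns ! i"
  have N: "0 < N" using pos i by (simp add: N_def)
  define e where "e k = cis (2 * pi * real k / real N)" for k
  have e_add: "e (k + l) = e k * e l" for k l by (simp add: e_def cis_mult distrib_left add_divide_distrib)
  have e_mult: "e (N * k) = 1" for k
    using N cis_multiple_2pi[of "real k"] by (simp add: e_def mult.assoc)
  have e_mod: "e (k mod N) = e k" for k
  proof -
    have "e k = e (N * (k div N) + k mod N)" by simp
    then show ?thesis unfolding e_add e_mult by simp
  qed
  show ?thesis
  proof (intro exI[of _ "\<lambda>x. e (\<iota> x ! i)"] conjI ballI allI)
    show "e (\<iota> (x \<otimes> y) ! i) = e (\<iota> x ! i) * e (\<iota> y ! i)" if "x \<in> carrier G" "y \<in> carrier G" for x y
      using i iota_mult[OF that] by (simp add: shift_index_def N_def[symmetric] e_mod e_add)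
    show "norm (e (\<iota> x ! i)) = 1" for x by (simp add: e_def)
    \<comment> \<open>The values of \<open>e\<close> below \<open>N\<close> are the distinct
      \<open>N\<close>-th roots of unity, so a nonzero coordinate is not sent to 1.\<close>
    have inj: "inj_on e {..<N}"
      using bij_betw_roots_unity[OF N] unfolding e_def by (rule bij_betw_imp_inj_on)
    have "\<iota> s ! i < N" using iota(1)[OF s(1)] i by (simp add: array_indices_def N_def)
    then have "e (\<iota> s ! i) \<noteq> e 0" using inj_onD[OF inj, of "\<iota> s ! i" 0] i N by auto
    then show "e (\<iota> s ! i) \<noteq> 1" by (simp add: e_def)
  qed
qed

text \<open>Reindexing by \<open>elem\<close> moves the sum to the group, and injectivity of
  \<open>elem\<close> makes a nonzero shift a nontrivial translation.\<close>

lemma perfect_array_of_function: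
  fixes F :: "'a \<Rightarrow> complex"
  assumes root: "\<And>x. x \<in> carrier G \<Longrightarrow> F x ^ h = 1"
    and autocorrelation: "\<And>s. s \<in> carrier G \<Longrightarrow> s \<noteq> \<one> \<Longrightarrow> (\<Sum>x \<in> carrier G. F x * cnj (F (x \<otimes> s))) = 0"
  shows "perfect_phase_array h ns (\<lambda>is. F (elem is))"
  unfolding perfect_phase_array_def
proof (intro conjI ballI impI)
  show "F (elem is) ^ h = 1" for "is" using root by simp
  fix ss assume ss: "ss \<in> array_indices ns" "ss \<noteq> replicate (length ns) 0"
  have "elem ss \<noteq> \<one>"
    using ss bij_elem replicate_in_array_indices[of ns] pos elem_zero
    by (metis bij_betw_imp_inj_on inj_onD)
  then have "(\<Sum>x \<in> carrier G. F x * cnj (F (x \<otimes> elem ss))) = 0" using autocorrelation by simp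
  moreover have "(\<Sum>is \<in> array_indices ns. F (elem is) * cnj (F (elem is \<otimes> elem ss))) =
      (\<Sum>x \<in> carrier G. F x * cnj (F (x \<otimes> elem ss)))"
    by (rule sum.reindex_bij_betw[OF bij_elem])
  ultimately show "(\<Sum>is \<in> array_indices ns. F (elem is) * cnj (F (elem (shift_index ns is ss)))) = 0"
    by (simp add: elem_shift)
qed

end

section \<open>Vanishing sums of roots of unity of prescribed length\<close>

lemma balanced_roots_of_unity:
  fixes c :: "nat \<Rightarrow> nat"
  assumes "0 < h" "N = (\<Sum>q \<in> prime_factors h. q * c q)"
  shows "\<exists>f :: nat \<Rightarrow> complex. (\<forall>i. f i ^ h = 1) \<and> (\<Sum>i<N. f i) = 0"
proof -
  \<comment> \<open>A triple \<open>(q, i, j)\<close> stands for the \<open>j\<close>-th power of a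
    primitive \<open>q\<close>-th root of unity in the \<open>i\<close>-th of \<open>c q\<close>
    copies of the full set; every copy sums to zero because \<open>q > 1\<close>.\<close>
  define D where "D = Sigma (prime_factors h) (\<lambda>q. {..<c q} \<times> {..<q})"
  define e where "e = (\<lambda>(q::nat, i::nat, j). cis (2 * pi * real j / real q))"
  have fin: "finite D" by (simp add: D_def)
  have "card D = N" using assms by (simp add: D_def card_cartesian_product mult.commute)
  then obtain b where b: "bij_betw b {..<N} D"
    using finite_same_card_bij[of "{..<N}" D] fin by auto
  have root: "e d ^ h = 1" if "d \<in> D" for d
  proof -
    obtain q i j where d: "d = (q, i, j)" by (cases d)
    have q: "q dvd h" "0 < q" "j < q" using that d by (auto simp: D_def dest: in_prime_factors_imp_dvd)
    have "e d ^ q = 1" using bij_betw_apply[OF bij_betw_roots_unity[OF q(2)], of j] q by (simp add: d e_def)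
    moreover obtain m where "h = q * m" using q by blast
    ultimately show ?thesis by (simp add: power_mult)
  qed
  have zero: "(\<Sum>d \<in> D. e d) = 0"
  proof -
    have "(\<Sum>d \<in> D. e d) = (\<Sum>q \<in> prime_factors h. \<Sum>i<c q. \<Sum>j<q. e (q, i, j))"
      by (simp add: D_def sum.Sigma sum.cartesian_product)
    also have "\<dots> = 0"
    proof (rule sum.neutral, rule ballI)
      fix q :: nat assume "q \<in> prime_factors h"
      then have "Factorial_Ring.prime q" by (simp add: in_prime_factors_iff)
      then have q: "1 < q" by (rule prime_gt_1_nat)
      have "(\<Sum>j<q. e (q, i, j)) = (\<Sum>{z::complex. z ^ q = 1})" for i
        using sum.reindex_bij_betw[OF bij_betw_roots_unity, of q "\<lambda>z. z"] q by (simp add: e_def)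
      then show "(\<Sum>i<c q. \<Sum>j<q. e (q, i, j)) = 0" using sum_roots_unity[OF q] by simp
    qed
    finally show ?thesis .
  qed
  show ?thesis
  \<comment> \<open>The value 1 from \<open>N\<close> onwards makes the root condition hold at every
    index.\<close>
  proof (intro exI[of _ "\<lambda>i. if i < N then e (b i) else 1"] conjI allI)
    show "(if i < N then e (b i) else 1) ^ h = 1" for i using root bij_betw_apply[OF b] by simp
    have "(\<Sum>i<N. if i < N then e (b i) else 1) = (\<Sum>i<N. e (b i))" by simp
    also have "\<dots> = (\<Sum>d \<in> D. e d)" by (rule sum.reindex_bij_betw[OF b])
    finally show "(\<Sum>i<N. if i < N then e (b i) else 1) = 0" using zero by simp
  qed
qed

section \<open>Finite chain rings\<close>

text \<open>Locality is put as the dichotomy between units and multiples of \<open>\<pi>\<close>; it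
  makes every nonzero element a power of \<open>\<pi>\<close> times a unit.\<close>

locale finite_chain_ring = cring R for R (structure) +
  fixes \<pi> :: 'a and n :: nat
  assumes finite_carrier: "finite (carrier R)"
    and gen_closed [simp, intro]: "\<pi> \<in> carrier R"
    and n_pos: "0 < n"
    and gen_pow_ne: "\<pi> [^] (n - 1) \<noteq> \<zero>"
    and gen_pow_zero: "\<pi> [^] n = \<zero>"
    and unit_or_multiple: "x \<in> carrier R \<Longrightarrow> x \<notin> PIdl \<pi> \<Longrightarrow> x \<in> Units R"
begin

section \<open>Powers of the maximal ideal and the valuation they define\<close>

definition P :: "nat \<Rightarrow> 'a set" where "P k = PIdl (\<pi> [^] k)"

lemma P_ideal: "ideal (P k) R"
  unfolding P_def by (rule cgenideal_ideal) simp

lemma P_closed [simp]: "x \<in> P k \<Longrightarrow> x \<in> carrier R"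
  using ideal.Icarr[OF P_ideal] .

lemma P_add: "x \<in> P k \<Longrightarrow> y \<in> P k \<Longrightarrow> x \<oplus> y \<in> P k"
  using P_ideal[of k] by (simp add: additive_subgroup.a_closed ideal.axioms(1))

lemma P_minus: "x \<in> P k \<Longrightarrow> y \<in> P k \<Longrightarrow> x \<ominus> y \<in> P k"
  using P_ideal[of k]
  by (simp add: additive_subgroup.a_closed additive_subgroup.a_inv_closed ideal.axioms(1) minus_eq)

lemma P_zero [simp]: "\<zero> \<in> P k"
  using P_ideal[of k] by (simp add: additive_subgroup.zero_closed ideal.axioms(1))

lemma P_mult: "x \<in> P k \<Longrightarrow> r \<in> carrier R \<Longrightarrow> r \<otimes> x \<in> P k"
  using ideal.I_l_closed[OF P_ideal] .

lemma finite_P: "finite (P k)"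
  using finite_subset[OF subsetI finite_carrier] P_closed by blast

lemma P_I: "z \<in> carrier R \<Longrightarrow> \<pi> [^] k \<otimes> z \<in> P k"
  unfolding P_def cgenideal_def using m_comm by auto

lemma P_E: assumes "x \<in> P k" obtains z where "z \<in> carrier R" "x = \<pi> [^] k \<otimes> z"
  using assms unfolding P_def cgenideal_def by (auto simp: m_comm)

lemma P_0 [simp]: "P 0 = carrier R"
  using P_I[of _ 0] by (auto)

lemma P_n: "k \<ge> n \<Longrightarrow> P k = {\<zero>}"
proof -
  assume "k \<ge> n"
  then have "\<pi> [^] k = \<pi> [^] n \<otimes> \<pi> [^] (k - n)" by (simp add: nat_pow_mult)
  then have "\<pi> [^] k = \<zero>" by (simp add: gen_pow_zero)
  then show ?thesis by (auto elim!: P_E)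
qed

lemma P_mult_P: "x \<in> P k \<Longrightarrow> y \<in> P l \<Longrightarrow> x \<otimes> y \<in> P (k + l)"
proof (elim P_E)
  fix z w assume z: "z \<in> carrier R" "x = \<pi> [^] k \<otimes> z" "w \<in> carrier R" "y = \<pi> [^] l \<otimes> w"
  have "\<pi> [^] (k + l) = \<pi> [^] k \<otimes> \<pi> [^] l" by (simp add: nat_pow_mult)
  then have "x \<otimes> y = \<pi> [^] (k + l) \<otimes> (z \<otimes> w)" using z by (simp add: m_ac)
  then show ?thesis using z P_I by simp
qed

lemma P_antimono: "k \<le> l \<Longrightarrow> P l \<subseteq> P k"
proof
  fix x assume "k \<le> l" "x \<in> P l"
  then obtain z where z: "z \<in> carrier R" "x = \<pi> [^] l \<otimes> z" by (auto elim: P_E)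
  have "\<pi> [^] l = \<pi> [^] k \<otimes> \<pi> [^] (l - k)" using \<open>k \<le> l\<close> by (simp add: nat_pow_mult)
  then show "x \<in> P k" using z P_I[of "\<pi> [^] (l - k) \<otimes> z" k] by (simp add: m_assoc)
qed

lemma P_1: "P 1 = PIdl \<pi>"
  by (simp add: P_def)

text \<open>Zero has valuation \<open>n\<close>.\<close>

definition val :: "'a \<Rightarrow> nat" where "val x = (GREATEST k. k \<le> n \<and> x \<in> P k)"

lemma val_props:
  assumes "x \<in> carrier R"
  shows "val x \<le> n" "x \<in> P (val x)" "k \<le> n \<Longrightarrow> x \<in> P k \<Longrightarrow> k \<le> val x"
proof -
  have "0 \<le> n \<and> x \<in> P 0" using assms by simp
  then have "val x \<le> n \<and> x \<in> P (val x)" unfolding val_def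
    by (rule GreatestI_nat[where b = n]) auto
  then show "val x \<le> n" "x \<in> P (val x)" by auto
  show "k \<le> n \<Longrightarrow> x \<in> P k \<Longrightarrow> k \<le> val x"
    unfolding val_def by (rule Greatest_le_nat[where b = n]) auto
qed

lemma in_P_iff: "x \<in> carrier R \<Longrightarrow> k \<le> n \<Longrightarrow> x \<in> P k \<longleftrightarrow> k \<le> val x"
  using val_props[of x] P_antimono[of k "val x"] by blast

text \<open>A cofactor that is not a unit would be a multiple of \<open>\<pi>\<close> and raise the
  valuation.\<close>

lemma val_unit:
  assumes "x \<in> carrier R" "val x < n"
  obtains w where "w \<in> Units R" "x = \<pi> [^] val x \<otimes> w"
proof -
  obtain w where w: "w \<in> carrier R" "x = \<pi> [^] val x \<otimes> w" using val_props(2)[OF assms(1)] by (rule P_E)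
  have "w \<in> Units R"
  proof (rule ccontr)
    assume "w \<notin> Units R"
    then have "w \<in> P 1" using unit_or_multiple[of w] w P_1 by auto
    then have "x \<in> P (val x + 1)" using w P_mult_P[of "\<pi> [^] val x" "val x" w 1] P_I[of \<one> "val x"] by simp
    then show False using val_props(3)[OF assms(1), of "val x + 1"] assms(2) by simp
  qed
  then show ?thesis using w that by blast
qed

lemma val_zero: "val \<zero> = n"
  using val_props[of \<zero>] by (simp add: P_n antisym)

lemma val_eq_n: "x \<in> carrier R \<Longrightarrow> val x = n \<longleftrightarrow> x = \<zero>"
  by (metis P_n le_refl singletonD val_props(2) val_zero)

lemma unit_cancel:
  "w \<in> Units R \<Longrightarrow> a \<in> carrier R \<Longrightarrow> inv w \<otimes> (w \<otimes> a) = a"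
  "w \<in> Units R \<Longrightarrow> a \<in> carrier R \<Longrightarrow> w \<otimes> (inv w \<otimes> a) = a"
  by (simp_all add: Units_closed m_assoc[symmetric])

text \<open>If \<open>z\<close> had valuation below \<open>n - k\<close>, the nonzero power
  \<open>\<pi> [^] (n - 1)\<close> would be a multiple of
  \<open>\<pi> [^] k \<otimes> z\<close>.\<close>

lemma pow_mult_eq_zero:
  assumes z: "z \<in> carrier R" and k: "k \<le> n" and eq: "\<pi> [^] k \<otimes> z = \<zero>"
  shows "z \<in> P (n - k)"
proof (rule ccontr)
  assume "z \<notin> P (n - k)"
  then have v: "val z < n - k" using in_P_iff[OF z, of "n - k"] by simp
  define l where "l = val z"
  obtain w where w: "w \<in> Units R" "z = \<pi> [^] l \<otimes> w"
    unfolding l_def using val_unit z v by (metis less_le_trans diff_le_self)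
  have "\<pi> [^] (n - 1) = \<pi> [^] (n - 1 - k - l) \<otimes> (\<pi> [^] k \<otimes> \<pi> [^] l)"
    using v by (simp add: l_def nat_pow_mult)
  also have "\<dots> = \<pi> [^] (n - 1 - k - l) \<otimes> inv w \<otimes> (\<pi> [^] k \<otimes> z)"
    unfolding w(2) using w(1) Units_closed[OF w(1)] by (simp add: m_ac unit_cancel)
  finally show False using eq gen_pow_ne w by simp
qed

text \<open>Cancelling \<open>\<pi> [^] k\<close> is possible only up to its annihilator
  \<open>P (n - k)\<close>, which is harmless because it lies in \<open>P (l - k)\<close>.\<close>

lemma pow_mult_in_P:
  assumes z: "z \<in> carrier R" and kl: "k \<le> l" "l \<le> n" and mem: "\<pi> [^] k \<otimes> z \<in> P l"
  shows "z \<in> P (l - k)"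
proof -
  obtain c where c: "c \<in> carrier R" "\<pi> [^] k \<otimes> z = \<pi> [^] l \<otimes> c" using mem by (rule P_E)
  have "\<pi> [^] l = \<pi> [^] k \<otimes> \<pi> [^] (l - k)" using kl by (simp add: nat_pow_mult)
  then have "\<pi> [^] k \<otimes> (z \<ominus> \<pi> [^] (l - k) \<otimes> c) = \<pi> [^] k \<otimes> z \<ominus> \<pi> [^] l \<otimes> c"
    using z c(1) by (simp add: minus_eq r_distr r_minus m_assoc)
  also have "\<dots> = \<zero>" using c z by (simp add: r_right_minus_eq)
  finally have "z \<ominus> \<pi> [^] (l - k) \<otimes> c \<in> P (n - k)"
    using pow_mult_eq_zero z c(1) kl by simp
  then have 1: "z \<ominus> \<pi> [^] (l - k) \<otimes> c \<in> P (l - k)" using P_antimono[of "l - k" "n - k"] kl diff_le_mono[of l n k] by blast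
  have "z = (z \<ominus> \<pi> [^] (l - k) \<otimes> c) \<oplus> \<pi> [^] (l - k) \<otimes> c"
    using z c(1) by (simp add: minus_eq a_assoc l_neg)
  then show ?thesis using P_add[OF 1 P_I[OF c(1), of "l - k"]] by simp
qed

text \<open>Multiplying by a unit and a power of \<open>\<pi>\<close> turns \<open>z\<close> into
  \<open>\<pi> [^] (n - 1)\<close>. Hence a character that is nontrivial on the socle is nontrivial
  on every nonzero ideal.\<close>

lemma socle_multiple:
  assumes "z \<in> carrier R" "z \<noteq> \<zero>" "s \<in> P (n - 1)"
  obtains c where "c \<in> carrier R" "s = c \<otimes> z"
proof -
  have v: "val z < n" using assms val_props(1)[of z] val_eq_n[of z] by linarith
  define l where "l = val z"
  obtain w where w: "w \<in> Units R" "z = \<pi> [^] l \<otimes> w"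
    unfolding l_def using val_unit[OF assms(1) v] .
  obtain c where c: "c \<in> carrier R" "s = \<pi> [^] (n - 1) \<otimes> c" using assms(3) by (rule P_E)
  have "\<pi> [^] (n - 1) = \<pi> [^] (n - 1 - l) \<otimes> \<pi> [^] l" using v by (simp add: l_def nat_pow_mult)
  then have "s = (c \<otimes> inv w \<otimes> \<pi> [^] (n - 1 - l)) \<otimes> z"
    unfolding w(2) using c w(1) Units_closed[OF w(1)] by (simp add: m_ac unit_cancel)
  then show ?thesis by (rule that[rotated]) (use c w in simp)
qed

text \<open>Links \<open>P\<close> to the ideal powers occurring in
  \<open>root_system\<close>.\<close>

lemma P_pow: "ideal_power R (P 1) k = P k"
proof (induct k)
  case 0 show ?case by (simp add: ideals_set_def)
next
  case (Suc k)
  have "x \<in> P (k + 1)" if "x \<in> ideal_prod R (P k) (P 1)" for x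
    using that by (induct x rule: ideal_prod.induct) (auto intro: P_mult_P[of _ k _ 1, simplified] P_add)
  moreover have "x \<in> ideal_prod R (P k) (P 1)" if "x \<in> P (k + 1)" for x
  proof -
    obtain z where z: "z \<in> carrier R" "x = \<pi> [^] (k + 1) \<otimes> z" using \<open>x \<in> P (k + 1)\<close> by (rule P_E)
    then have "x = \<pi> [^] k \<otimes> (\<pi> [^] (1::nat) \<otimes> z)" by (simp add: m_assoc)
    moreover have "\<pi> [^] k \<in> P k" using P_I[of \<one> k] by simp
    ultimately show ?thesis using P_I[OF z(1), of 1] by (metis ideal_prod.prod)
  qed
  ultimately have "ideal_prod R (P k) (P 1) = P (k + 1)" by blast
  then show ?case using Suc by (simp add: ideals_set_def)
qed

subsection \<open>Self-dual submodules of the plane\<close>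

definition V :: "('a \<times> 'a) set" where "V = carrier R \<times> carrier R"

lemma V_pair [simp]: "(x, y) \<in> V \<longleftrightarrow> x \<in> carrier R \<and> y \<in> carrier R"
  by (simp add: V_def)

lemma V_iff: "p \<in> V \<longleftrightarrow> fst p \<in> carrier R \<and> snd p \<in> carrier R"
  by (simp add: V_def mem_Times_iff)

lemma neg_eq_zero_iff: "x \<in> carrier R \<Longrightarrow> \<ominus> x = \<zero> \<longleftrightarrow> x = \<zero>"
  by (metis minus_minus minus_zero)

definition padd :: "'a \<times> 'a \<Rightarrow> 'a \<times> 'a \<Rightarrow> 'a \<times> 'a" where
  "padd p q = (fst p \<oplus> fst q, snd p \<oplus> snd q)"

text \<open>The determinant of the matrix with rows \<open>p\<close> and \<open>s\<close>.\<close>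

definition symp :: "'a \<times> 'a \<Rightarrow> 'a \<times> 'a \<Rightarrow> 'a" where
  "symp p s = fst p \<otimes> snd s \<ominus> snd p \<otimes> fst s"

definition submodule2 :: "('a \<times> 'a) set \<Rightarrow> bool" where
  "submodule2 L \<longleftrightarrow> L \<subseteq> V \<and> L \<noteq> {} \<and> (\<forall>p \<in> L. \<forall>q \<in> L. padd p q \<in> L) \<and>
     (\<forall>c \<in> carrier R. \<forall>p \<in> L. (c \<otimes> fst p, c \<otimes> snd p) \<in> L)"

text \<open>Orthogonality refers to the ring-valued form, so the notion involves no character;
  \<open>char_sum_zero\<close> passes to characters that are nontrivial on the socle.\<close>

definition self_dual :: "('a \<times> 'a) set \<Rightarrow> bool" where
  "self_dual L \<longleftrightarrow> submodule2 L \<and> (\<forall>s \<in> V. s \<in> L \<longleftrightarrow> (\<forall>p \<in> L. symp p s = \<zero>))"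

lemma finite_V: "finite V"
  using finite_carrier by (simp add: V_def)

lemma padd_closed [simp]: "p \<in> V \<Longrightarrow> q \<in> V \<Longrightarrow> padd p q \<in> V"
  by (auto simp: V_iff padd_def)

lemma symp_closed [simp]: "p \<in> V \<Longrightarrow> q \<in> V \<Longrightarrow> symp p q \<in> carrier R"
  by (auto simp: V_iff symp_def)

lemma symp_padd_left: "p \<in> V \<Longrightarrow> q \<in> V \<Longrightarrow> s \<in> V \<Longrightarrow> symp (padd p q) s = symp p s \<oplus> symp q s"
  by (auto simp: V_iff symp_def padd_def l_distr minus_eq minus_add a_ac)

lemma symp_padd_right: "p \<in> V \<Longrightarrow> q \<in> V \<Longrightarrow> s \<in> V \<Longrightarrow> symp s (padd p q) = symp s p \<oplus> symp s q"
  by (auto simp: V_iff symp_def padd_def r_distr minus_eq minus_add a_ac)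

lemma symp_smult: "p \<in> V \<Longrightarrow> s \<in> V \<Longrightarrow> c \<in> carrier R \<Longrightarrow> symp (c \<otimes> fst p, c \<otimes> snd p) s = c \<otimes> symp p s"
  by (auto simp: V_iff symp_def r_distr minus_eq r_minus m_assoc)

lemma symp_commute: "p \<in> V \<Longrightarrow> s \<in> V \<Longrightarrow> symp s p = \<ominus> symp p s"
  by (auto simp: V_iff symp_def minus_eq minus_add a_ac m_ac)

lemma symp_swap: "p \<in> V \<Longrightarrow> s \<in> V \<Longrightarrow> symp (prod.swap p) (prod.swap s) = \<ominus> symp p s"
  by (auto simp: V_iff symp_def minus_eq minus_add a_ac m_ac)

lemma padd_right_cancel: "p \<in> V \<Longrightarrow> q \<in> V \<Longrightarrow> s \<in> V \<Longrightarrow> padd s p = padd s q \<longleftrightarrow> p = q"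
  by (auto simp: V_iff padd_def prod_eq_iff)

text \<open>Swapping the coordinates negates \<open>symp\<close> and so preserves
  orthogonality.\<close>

lemma self_dual_swap:
  assumes "self_dual L"
  shows "self_dual (prod.swap ` L)"
proof -
  have L: "submodule2 L" "L \<subseteq> V" and d: "\<And>s. s \<in> V \<Longrightarrow> s \<in> L \<longleftrightarrow> (\<forall>p \<in> L. symp p s = \<zero>)"
    using assms unfolding self_dual_def submodule2_def by blast+
  have "submodule2 (prod.swap ` L)" using L
    unfolding submodule2_def padd_def by (auto simp: V_iff)
  moreover have "s \<in> prod.swap ` L \<longleftrightarrow> (\<forall>p \<in> prod.swap ` L. symp p s = \<zero>)" if s: "s \<in> V" for s
  proof -
    have s': "prod.swap s \<in> V" using s by (simp add: V_iff)
    have "s \<in> prod.swap ` L \<longleftrightarrow> prod.swap s \<in> L" by (metis image_iff swap_swap)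
    also have "\<dots> \<longleftrightarrow> (\<forall>p \<in> L. symp p (prod.swap s) = \<zero>)" by (rule d[OF s'])
    also have "\<dots> \<longleftrightarrow> (\<forall>p \<in> L. symp (prod.swap p) s = \<zero>)"
    proof (intro ball_cong refl)
      fix p assume "p \<in> L"
      then have "p \<in> V" using L by auto
      have "symp (prod.swap p) s = symp (prod.swap p) (prod.swap (prod.swap s))" by simp
      also have "\<dots> = \<ominus> symp p (prod.swap s)" by (rule symp_swap[OF \<open>p \<in> V\<close> s'])
      finally show "symp p (prod.swap s) = \<zero> \<longleftrightarrow> symp (prod.swap p) s = \<zero>"
        using symp_closed[OF \<open>p \<in> V\<close> s'] by (simp add: neg_eq_zero_iff)
    qed
    finally show ?thesis by simp
  qed
  ultimately show ?thesis by (simp add: self_dual_def)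
qed

text \<open>For \<open>2 k \<le> n\<close> this is \<open>\<pi>^k R (1, r) + \<pi>^(n - k) R\<^sup>2\<close>, which depends only on \<open>r\<close> modulo \<open>\<pi>^(n - 2 * k)\<close>.
  The lines through \<open>(s, 1)\<close> are obtained by swapping coordinates.\<close>

definition leaf :: "nat \<Rightarrow> 'a \<Rightarrow> ('a \<times> 'a) set" where
  "leaf k r = {(x, y). x \<in> P k \<and> y \<in> carrier R \<and> y \<ominus> r \<otimes> x \<in> P (n - k)}"

text \<open>Isotropy comes from \<open>P k\<close> times \<open>P (n - k)\<close> being zero.
  Conversely, orthogonality to the generators \<open>(\<zero>, \<pi> [^] (n - k))\<close> and
  \<open>(\<pi> [^] k, r \<otimes> \<pi> [^] k)\<close> forces the two defining conditions.\<close>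

lemma self_dual_leaf:
  assumes k: "k \<le> n" and r: "r \<in> carrier R"
  shows "self_dual (leaf k r)"
proof -
  have "submodule2 (leaf k r)"
    unfolding submodule2_def
  proof (intro conjI ballI)
    show "leaf k r \<subseteq> V" by (auto simp: leaf_def)
    have "(\<zero>, \<zero>) \<in> leaf k r" using r by (simp add: leaf_def minus_eq)
    then show "leaf k r \<noteq> {}" by auto
  next
    fix p q assume "p \<in> leaf k r" "q \<in> leaf k r"
    then obtain x y x' y' where *: "p = (x, y)" "q = (x', y')" "x \<in> P k" "y \<in> carrier R" "x' \<in> P k" "y' \<in> carrier R"
      "y \<ominus> r \<otimes> x \<in> P (n - k)" "y' \<ominus> r \<otimes> x' \<in> P (n - k)" by (auto simp: leaf_def)
    have "(y \<oplus> y') \<ominus> r \<otimes> (x \<oplus> x') = (y \<ominus> r \<otimes> x) \<oplus> (y' \<ominus> r \<otimes> x')"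
      using * P_closed r by (simp add: r_distr minus_eq minus_add a_ac)
    then show "padd p q \<in> leaf k r" using * P_add[of x k x'] P_add[OF *(7,8)] by (simp add: leaf_def padd_def)
  next
    fix c p assume "c \<in> carrier R" "p \<in> leaf k r"
    then obtain x y where *: "c \<in> carrier R" "p = (x, y)" "x \<in> P k" "y \<in> carrier R" "y \<ominus> r \<otimes> x \<in> P (n - k)"
      by (auto simp: leaf_def)
    have "c \<otimes> y \<ominus> r \<otimes> (c \<otimes> x) = c \<otimes> (y \<ominus> r \<otimes> x)"
      using * P_closed r by (simp add: r_distr minus_eq r_minus m_ac)
    then show "(c \<otimes> fst p, c \<otimes> snd p) \<in> leaf k r" using * P_mult[of x k c] P_mult[OF *(5,1)] by (simp add: leaf_def)
  qed
  moreover have "s \<in> leaf k r \<longleftrightarrow> (\<forall>p \<in> leaf k r. symp p s = \<zero>)" if sV: "s \<in> V" for s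
  proof -
    obtain x' y' where s: "s = (x', y')" "x' \<in> carrier R" "y' \<in> carrier R" using sV by (cases s) auto
    show ?thesis
    proof
      assume "s \<in> leaf k r"
      then have x': "x' \<in> P k" "y' \<ominus> r \<otimes> x' \<in> P (n - k)" by (auto simp: s leaf_def)
      show "\<forall>p \<in> leaf k r. symp p s = \<zero>"
      proof
        fix p assume "p \<in> leaf k r"
        then obtain x y where p: "p = (x, y)" "x \<in> P k" "y \<in> carrier R" "y \<ominus> r \<otimes> x \<in> P (n - k)"
          by (auto simp: leaf_def)
        have 1: "x \<otimes> (y' \<ominus> r \<otimes> x') = \<zero>" using P_mult_P[OF p(2) x'(2)] k by (simp add: P_n)
        have 2: "x' \<otimes> (y \<ominus> r \<otimes> x) = \<zero>" using P_mult_P[OF x'(1) p(4)] k by (simp add: P_n)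
        have x: "x \<in> carrier R" using p by simp
        have a: "r \<otimes> (x' \<otimes> x) \<in> carrier R" "x \<otimes> y' \<in> carrier R" "\<ominus> (x' \<otimes> y) \<in> carrier R"
          using p s r x by simp_all
        have "symp p s = x \<otimes> y' \<oplus> \<ominus> (x' \<otimes> y)"
          using s p x by (simp add: symp_def minus_eq m_ac)
        \<comment> \<open>Inserting \<open>r \<otimes> (x' \<otimes> x)\<close> exhibits the
          deviation of each vector from slope \<open>r\<close>, which is killed by the first
          coordinate of the other vector.\<close>
        also have "\<dots> = (x \<otimes> y' \<oplus> \<ominus> (r \<otimes> (x' \<otimes> x))) \<oplus> (r \<otimes> (x' \<otimes> x) \<oplus> \<ominus> (x' \<otimes> y))"
          using a by (simp add: a_assoc r_neg1)
        also have "\<dots> = x \<otimes> (y' \<ominus> r \<otimes> x') \<ominus> x' \<otimes> (y \<ominus> r \<otimes> x)"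
          using s p r x by (simp add: minus_eq r_distr r_minus minus_add m_ac a_ac)
        finally show "symp p s = \<zero>" by (simp add: 1 2)
      qed
    next
      assume orth: "\<forall>p \<in> leaf k r. symp p s = \<zero>"
      have "(\<zero>, \<pi> [^] (n - k)) \<in> leaf k r" using P_I[of \<one> "n - k"] r by (simp add: leaf_def minus_eq)
      with orth have "symp (\<zero>, \<pi> [^] (n - k)) s = \<zero>" by blast
      then have "\<pi> [^] (n - k) \<otimes> x' = \<zero>" using s by (simp add: symp_def minus_eq neg_eq_zero_iff)
      then have x': "x' \<in> P k" using pow_mult_eq_zero[of x' "n - k"] s k by simp
      have "(\<pi> [^] k, r \<otimes> \<pi> [^] k) \<in> leaf k r" using P_I[of \<one> "k"] r by (simp add: leaf_def minus_eq r_neg)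
      with orth have "symp (\<pi> [^] k, r \<otimes> \<pi> [^] k) s = \<zero>" by blast
      then have "\<pi> [^] k \<otimes> (y' \<ominus> r \<otimes> x') = \<zero>" using s r by (simp add: symp_def minus_eq r_distr r_minus m_ac)
      then have "y' \<ominus> r \<otimes> x' \<in> P (n - k)" using pow_mult_eq_zero[of "y' \<ominus> r \<otimes> x'" k] s k r by simp
      then show "s \<in> leaf k r" using s x' by (simp add: leaf_def)
    qed
  qed
  ultimately show ?thesis by (simp add: self_dual_def)
qed

subsection \<open>Weighted sums of leaves\<close>

text \<open>Membership means \<open>(r0 \<ominus> r) \<otimes> x \<in> P (n - k)\<close>, and
  cancelling \<open>x\<close> lowers the exponent by \<open>val x\<close>. Truncated subtraction
  gives \<open>P 0\<close>, the whole ring, when no condition on the slope is left.\<close>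

lemma leaf_iff_slope:
  assumes x: "x \<in> P k" and k: "k \<le> n" and r: "r \<in> carrier R" "r0 \<in> carrier R"
  shows "(x, r0 \<otimes> x) \<in> leaf k r \<longleftrightarrow> r0 \<ominus> r \<in> P (n - k - val x)"
proof -
  have xR: "x \<in> carrier R" using x by simp
  have eq: "r0 \<otimes> x \<ominus> r \<otimes> x = (r0 \<ominus> r) \<otimes> x" using xR r by (simp add: minus_eq l_distr l_minus)
  have "(x, r0 \<otimes> x) \<in> leaf k r \<longleftrightarrow> (r0 \<ominus> r) \<otimes> x \<in> P (n - k)"
    using x xR r by (simp add: leaf_def eq)
  also have "\<dots> \<longleftrightarrow> r0 \<ominus> r \<in> P (n - k - val x)"
  proof
    assume "r0 \<ominus> r \<in> P (n - k - val x)"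
    then have "(r0 \<ominus> r) \<otimes> x \<in> P (n - k - val x + val x)" using val_props(2)[OF xR] by (rule P_mult_P)
    then show "(r0 \<ominus> r) \<otimes> x \<in> P (n - k)" by (rule subsetD[OF P_antimono, rotated]) simp
  next
    assume mem: "(r0 \<ominus> r) \<otimes> x \<in> P (n - k)"
    show "r0 \<ominus> r \<in> P (n - k - val x)"
    proof (cases "n - k \<le> val x")
      case True
      then show ?thesis using r by simp
    next
      case False
      define v where "v = val x"
      obtain w where w: "w \<in> Units R" "x = \<pi> [^] v \<otimes> w"
        unfolding v_def using val_unit[OF xR] False by (metis less_le_trans diff_le_self not_le)
      have wR: "w \<in> carrier R" "inv w \<in> carrier R" using w by auto
      have "\<pi> [^] v \<otimes> ((r0 \<ominus> r) \<otimes> w) = (r0 \<ominus> r) \<otimes> x" using r wR w(2) by (simp add: m_ac)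
      then have "(r0 \<ominus> r) \<otimes> w \<in> P (n - k - v)"
        using pow_mult_in_P[of "(r0 \<ominus> r) \<otimes> w" v "n - k"] mem False r wR v_def by simp
      then have "inv w \<otimes> ((r0 \<ominus> r) \<otimes> w) \<in> P (n - k - v)" by (rule P_mult) (rule wR)
      moreover have "inv w \<otimes> ((r0 \<ominus> r) \<otimes> w) = r0 \<ominus> r"
        using r wR unit_cancel(1)[OF w(1), of "r0 \<ominus> r"] by (simp add: m_comm)
      ultimately show ?thesis by (simp add: v_def)
    qed
  qed
  finally show ?thesis .
qed

text \<open>Up to a unit, \<open>x\<close> is a power of \<open>\<pi>\<close> that divides
  \<open>y\<close>. The surplus \<open>e\<close> records how far the slope lies in the maximal
  ideal.\<close>

lemma slope_exists:
  assumes x: "x \<in> carrier R" and y: "y \<in> P (val x + e)"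
  obtains r where "r \<in> P e" "y = r \<otimes> x"
proof (cases "val x < n")
  case True
  define v where "v = val x"
  obtain w where w: "w \<in> Units R" "x = \<pi> [^] v \<otimes> w" unfolding v_def using val_unit[OF x True] .
  have wR: "w \<in> carrier R" "inv w \<in> carrier R" using w by auto
  obtain z where z: "z \<in> carrier R" "y = \<pi> [^] (v + e) \<otimes> z" using y unfolding v_def by (rule P_E)
  have "\<pi> [^] (v + e) = \<pi> [^] v \<otimes> \<pi> [^] e" by (simp add: nat_pow_mult)
  then have "y = (\<pi> [^] e \<otimes> (z \<otimes> inv w)) \<otimes> x"
    unfolding w(2) using z wR w(1) by (simp add: m_ac unit_cancel)
  moreover have "\<pi> [^] e \<otimes> (z \<otimes> inv w) \<in> P e" using z wR by (simp add: P_I)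
  ultimately show ?thesis using that by blast
next
  case False
  then have "val x = n" using val_props(1)[OF x] by simp
  \<comment> \<open>Here \<open>x\<close> is zero and so is \<open>y\<close>; slope zero
    serves.\<close>
  then show ?thesis using that[of \<zero>] y x by (simp add: P_n)
qed

text \<open>The lines through a nonzero vector have slopes forming one residue class modulo
  \<open>P (n - val x)\<close>, or there are none. The case \<open>e = 0\<close> is for the lines
  through \<open>(1, r)\<close>, the case \<open>e = 1\<close> for slopes in the maximal ideal, used
  after a swap.\<close>

lemma leaf_sum_spread:
  assumes x: "x \<in> carrier R" and y: "y \<in> carrier R" and nz: "x \<noteq> \<zero> \<or> y \<noteq> \<zero>" and e: "e \<le> 1"
  shows "\<exists>r0 \<in> P e. \<exists>i. 1 \<le> i \<and> i \<le> n \<and> (\<Sum>r \<in> P e. f r * of_bool ((x, y) \<in> leaf 0 r)) =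
    (if val x + e \<le> val y then (\<Sum>r \<in> {r \<in> P e. r0 \<ominus> r \<in> P i}. f r) else (0::complex))"
proof (cases "val x + e \<le> val y")
  case True
  have "y \<in> P (val x + e)" using True val_props[OF y] P_antimono[of "val x + e" "val y"] by auto
  then obtain r0 where r0: "r0 \<in> P e" "y = r0 \<otimes> x" using slope_exists[OF x] by blast
  have "x \<noteq> \<zero>" using nz r0 by auto
  then have v: "val x < n" using val_props(1)[OF x] val_eq_n[OF x] by linarith
  have "(\<Sum>r \<in> P e. f r * of_bool ((x, y) \<in> leaf 0 r)) = (\<Sum>r \<in> P e. if r0 \<ominus> r \<in> P (n - val x) then f r else 0)"
    using leaf_iff_slope[of x 0 _ r0] x r0 by (intro sum.cong) auto
  also have "\<dots> = (\<Sum>r \<in> {r \<in> P e. r0 \<ominus> r \<in> P (n - val x)}. f r)"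
    using finite_P by (simp add: sum.inter_filter)
  finally show ?thesis using r0 v True by (intro bexI[of _ r0] exI[of _ "n - val x"]) auto
next
  case False
  have "(x, y) \<notin> leaf 0 r" if r: "r \<in> P e" for r
  proof
    assume "(x, y) \<in> leaf 0 r"
    then have "y = r \<otimes> x" using x y r by (simp add: leaf_def P_n)
    then have "y \<in> P (e + val x)" using P_mult_P[OF r val_props(2)[OF x]] by simp
    \<comment> \<open>\<open>in_P_iff\<close> is limited to exponents up to \<open>n\<close>. The
      bound could fail only for \<open>x = \<zero>\<close>, but then
      \<open>y = r \<otimes> x\<close> vanishes as well.\<close>
    moreover have "e + val x \<le> n"
    proof (rule ccontr)
      assume "\<not> e + val x \<le> n"
      then have "val x = n" using e val_props(1)[OF x] by linarith
      then show False using nz \<open>y = r \<otimes> x\<close> val_eq_n[OF x] r by simp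
    qed
    ultimately show False using False in_P_iff[OF y] by auto
  qed
  then have "(\<Sum>r \<in> P e. f r * of_bool ((x, y) \<in> leaf 0 r)) = 0" by simp
  \<comment> \<open>No line meets the vector; \<open>\<zero>\<close> and \<open>n\<close> are
    arbitrary admissible witnesses.\<close>
  then show ?thesis using False n_pos by (intro bexI[of _ \<zero>] exI[of _ n]) auto
qed

text \<open>Averaging over the translations by multiples of \<open>s\<close> leaves the sum over
  \<open>M\<close> unchanged, but replaces every term by a sum that is zero.\<close>

lemma sum_zero_of_translation_invariant:
  fixes g :: "'a \<Rightarrow> complex"
  assumes M: "M \<subseteq> carrier R" and s: "s \<in> carrier R"
    and inv: "\<And>r t. r \<in> M \<Longrightarrow> t \<in> carrier R \<Longrightarrow> r \<oplus> s \<otimes> t \<in> M"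
    and zero: "\<And>r. r \<in> carrier R \<Longrightarrow> (\<Sum>t \<in> carrier R. g (r \<oplus> s \<otimes> t)) = 0"
  shows "(\<Sum>r \<in> M. g r) = 0"
proof -
  have fin: "finite M" using finite_subset[OF M finite_carrier] .
  have "(\<Sum>r \<in> M. g (r \<oplus> s \<otimes> t)) = (\<Sum>r \<in> M. g r)" if t: "t \<in> carrier R" for t
  proof (rule sum.reindex_bij_betw)
    have inj: "inj_on (\<lambda>r. r \<oplus> s \<otimes> t) M" using M s t by (auto simp: inj_on_def subset_iff)
    have "(\<lambda>r. r \<oplus> s \<otimes> t) ` M \<subseteq> M" using inv t by blast
    then show "bij_betw (\<lambda>r. r \<oplus> s \<otimes> t) M M" using inj fin by (simp add: bij_betw_def endo_inj_surj)
  qed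
  then have "of_nat (card (carrier R)) * (\<Sum>r \<in> M. g r) = (\<Sum>t \<in> carrier R. \<Sum>r \<in> M. g (r \<oplus> s \<otimes> t))"
    by simp
  also have "\<dots> = (\<Sum>r \<in> M. \<Sum>t \<in> carrier R. g (r \<oplus> s \<otimes> t))" by (rule sum.swap)
  also have "\<dots> = 0" using zero M by (intro sum.neutral) auto
  finally show ?thesis using finite_carrier carrier_not_empty by auto
qed

text \<open>For \<open>val x < k\<close> no leaf of level \<open>k\<close> contains the vector, and
  for \<open>val x > k\<close> the weights cancel in fibres. For \<open>val x = k\<close> the slopes
  form one residue class modulo \<open>P (n - 2 * k)\<close>, on which \<open>g\<close> is constant,
  unless \<open>y\<close> has too small a valuation.\<close>

lemma leaf_sum_balanced:
  fixes g :: "'a \<Rightarrow> complex"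
  assumes x: "x \<in> carrier R" and y: "y \<in> carrier R" and k: "2 * k + e < n"
    and const: "\<And>r r'. r \<in> carrier R \<Longrightarrow> r' \<in> carrier R \<Longrightarrow> r \<ominus> r' \<in> P (n - 2 * k) \<Longrightarrow> g r = g r'"
    and zero: "\<And>r. r \<in> carrier R \<Longrightarrow> (\<Sum>t \<in> carrier R. g (r \<oplus> \<pi> [^] (n - 2 * k - 1) \<otimes> t)) = 0"
  shows "\<exists>r0 \<in> carrier R. (\<Sum>r \<in> P e. g r * of_bool ((x, y) \<in> leaf k r)) =
    (if val x = k \<and> k + e \<le> val y then of_nat (card (P (n - 2 * k))) * g r0 else 0)"
proof -
  define M where "M = {r \<in> P e. (x, y) \<in> leaf k r}"
  have M: "(\<Sum>r \<in> P e. g r * of_bool ((x, y) \<in> leaf k r)) = (\<Sum>r \<in> M. g r)"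
    using finite_P[of e] by (simp add: M_def sum.inter_filter[symmetric] of_bool_def if_distrib cong: if_cong)
  consider "val x < k" | "k < val x" | "val x = k" "val y < k + e" | "val x = k" "k + e \<le> val y" by linarith
  then show ?thesis
  proof cases
    case 1
    then have "M = {}" using in_P_iff[OF x, of k] k by (auto simp: M_def leaf_def)
    then show ?thesis using 1 by (auto simp: M)
  next
    case 2
    \<comment> \<open>As \<open>x \<in> P (k + 1)\<close>, changing the slope by a multiple of
      \<open>\<pi> [^] l\<close> changes \<open>r \<otimes> x\<close> by an element of
      \<open>P (n - k)\<close>; so \<open>M\<close> is a union of the fibres over which
      \<open>g\<close> sums to zero.\<close>
    define l where "l = n - 2 * k - 1"
    have xP: "x \<in> P (k + 1)" using 2 in_P_iff[OF x, of "k + 1"] val_props(1)[OF x] by simp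
    have "(\<Sum>r \<in> M. g r) = 0"
    proof (rule sum_zero_of_translation_invariant)
      show "M \<subseteq> carrier R" by (auto simp: M_def)
      show "\<pi> [^] l \<in> carrier R" by simp
    next
      fix r t assume r: "r \<in> M" and t: "t \<in> carrier R"
      have rR: "r \<in> carrier R" "r \<in> P e" "y \<ominus> r \<otimes> x \<in> P (n - k)" "x \<in> P k" using r by (auto simp: M_def leaf_def)
      have tl: "\<pi> [^] l \<otimes> t \<in> P l" using t by (rule P_I)
      moreover have "e \<le> l" using k by (simp add: l_def)
      ultimately have "\<pi> [^] l \<otimes> t \<in> P e" using P_antimono by blast
      then have 1: "r \<oplus> \<pi> [^] l \<otimes> t \<in> P e" using rR P_add by blast
      have "(\<pi> [^] l \<otimes> t) \<otimes> x \<in> P (l + (k + 1))" using P_mult_P[OF tl xP] .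
      moreover have "l + (k + 1) = n - k" using k by (simp add: l_def)
      ultimately have "(y \<ominus> r \<otimes> x) \<ominus> (\<pi> [^] l \<otimes> t) \<otimes> x \<in> P (n - k)" using P_minus[OF rR(3)] by simp
      moreover have "y \<ominus> (r \<oplus> \<pi> [^] l \<otimes> t) \<otimes> x = (y \<ominus> r \<otimes> x) \<ominus> (\<pi> [^] l \<otimes> t) \<otimes> x"
        using x y rR t by (simp add: minus_eq l_distr minus_add a_ac)
      ultimately show "r \<oplus> \<pi> [^] l \<otimes> t \<in> M" using 1 rR y by (simp add: M_def leaf_def)
    next
      show "(\<Sum>t \<in> carrier R. g (r \<oplus> \<pi> [^] l \<otimes> t)) = 0" if "r \<in> carrier R" for r
        using zero[OF that] by (simp add: l_def)
    qed
    then show ?thesis using 2 by (auto simp: M)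
  next
    case 3
    have "M = {}"
    proof (rule ccontr)
      assume "M \<noteq> {}"
      then obtain r where r: "r \<in> P e" "y \<ominus> r \<otimes> x \<in> P (n - k)" "x \<in> P k" by (auto simp: M_def leaf_def)
      have 1: "y \<ominus> r \<otimes> x \<in> P (k + e)" using P_antimono[of "k + e" "n - k"] r(2) k by fastforce
      have 2: "r \<otimes> x \<in> P (k + e)" using P_mult_P[OF r(1,3)] by (simp add: add.commute)
      have "y = (y \<ominus> r \<otimes> x) \<oplus> r \<otimes> x" using x y r by (simp add: minus_eq a_assoc l_neg)
      then have "y \<in> P (k + e)" using P_add[OF 1 2] by simp
      then show False using 3 in_P_iff[OF y, of "k + e"] k by simp
    qed
    then show ?thesis using 3 by (auto simp: M)
  next
    case 4
    have "y \<in> P (val x + e)" using 4 in_P_iff[OF y, of "k + e"] k by simp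
    then obtain r0 where r0: "r0 \<in> P e" "y = r0 \<otimes> x" using slope_exists[OF x] by blast
    have xk: "x \<in> P k" using val_props(2)[OF x] 4 by simp
    have nk: "n - k - val x = n - 2 * k" using 4 by simp
    have M': "M = {r \<in> P e. r0 \<ominus> r \<in> P (n - 2 * k)}"
      using leaf_iff_slope[OF xk, of _ r0] k r0 nk by (auto simp: M_def)
    \<comment> \<open>\<open>M\<close> is the residue class of \<open>r0\<close>; the involution
      sending \<open>t\<close> to \<open>r0 \<ominus> t\<close> matches it with the ideal and so
      counts it.\<close>
    have "bij_betw (\<lambda>t. r0 \<ominus> t) (P (n - 2 * k)) M"
    proof (rule bij_betw_byWitness[where f' = "\<lambda>t. r0 \<ominus> t"])
      have inv: "r0 \<ominus> (r0 \<ominus> t) = t" if "t \<in> carrier R" for t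
        using that P_closed[OF r0(1)] by (simp add: minus_eq minus_add r_neg1 r_neg2)
      show "\<forall>t \<in> P (n - 2 * k). r0 \<ominus> (r0 \<ominus> t) = t" "\<forall>t \<in> M. r0 \<ominus> (r0 \<ominus> t) = t"
        using inv by (auto simp: M')
      show "(\<lambda>t. r0 \<ominus> t) ` P (n - 2 * k) \<subseteq> M"
      proof clarify
        fix t assume t: "t \<in> P (n - 2 * k)"
        moreover have "e \<le> n - 2 * k" using k by simp
        ultimately have "t \<in> P e" using P_antimono by blast
        then show "r0 \<ominus> t \<in> M" using t inv[of t] P_minus[OF r0(1)] by (simp add: M')
      qed
      show "(\<lambda>t. r0 \<ominus> t) ` M \<subseteq> P (n - 2 * k)" by (auto simp: M')
    qed
    then have "card M = card (P (n - 2 * k))" by (simp add: bij_betw_same_card)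
    moreover have "g r = g r0" if "r \<in> M" for r
      using const[of r0 r] that r0 by (auto simp: M')
    ultimately have "(\<Sum>r \<in> M. g r) = of_nat (card (P (n - 2 * k))) * g r0" by simp
    then show ?thesis unfolding M using 4 by (intro bexI[OF _ P_closed[OF r0(1)]]) simp
  qed
qed

text \<open>Either \<open>val x \<le> val y\<close> or \<open>val y + 1 \<le> val x\<close>, so a
  nonzero vector meets exactly one of the two families of lines and receives one class sum. The
  origin lies on all lines, which is where the total sum enters.\<close>

lemma unimodular_spread_sum:
  fixes \<epsilon> \<mu> :: "'a \<Rightarrow> complex"
  assumes 1: "\<And>i r. 1 \<le> i \<Longrightarrow> i \<le> n \<Longrightarrow> r \<in> carrier R \<Longrightarrow> (\<Sum>r' \<in> {r' \<in> carrier R. r \<ominus> r' \<in> P i}. \<epsilon> r') ^ h = 1"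
    and 2: "\<And>i s. 1 \<le> i \<Longrightarrow> i \<le> n \<Longrightarrow> s \<in> P 1 \<Longrightarrow> (\<Sum>s' \<in> {s' \<in> P 1. s \<ominus> s' \<in> P i}. \<mu> s') ^ h = 1"
    and 3: "((\<Sum>r \<in> carrier R. \<epsilon> r) + (\<Sum>s \<in> P 1. \<mu> s)) ^ h = 1"
    and x: "x \<in> carrier R" and y: "y \<in> carrier R"
  shows "((\<Sum>r \<in> carrier R. \<epsilon> r * of_bool ((x, y) \<in> leaf 0 r)) +
    (\<Sum>s \<in> P 1. \<mu> s * of_bool ((y, x) \<in> leaf 0 s))) ^ h = 1"
proof (cases "x = \<zero> \<and> y = \<zero>")
  case True
  then have "(\<zero>, \<zero>) \<in> leaf 0 r" if "r \<in> carrier R" for r using that by (simp add: leaf_def minus_eq)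
  then show ?thesis using True 3 by simp
next
  case False
  obtain r0 i where i: "r0 \<in> carrier R" "1 \<le> i" "i \<le> n"
    "(\<Sum>r \<in> carrier R. \<epsilon> r * of_bool ((x, y) \<in> leaf 0 r)) =
      (if val x \<le> val y then (\<Sum>r \<in> {r \<in> carrier R. r0 \<ominus> r \<in> P i}. \<epsilon> r) else 0)"
    using leaf_sum_spread[of x y 0 \<epsilon>] False x y by auto
  obtain s0 j where j: "s0 \<in> P 1" "1 \<le> j" "j \<le> n"
    "(\<Sum>s \<in> P 1. \<mu> s * of_bool ((y, x) \<in> leaf 0 s)) =
      (if val y + 1 \<le> val x then (\<Sum>s \<in> {s \<in> P 1. s0 \<ominus> s \<in> P j}. \<mu> s) else 0)"
    using leaf_sum_spread[of y x 1 \<mu>] False x y by auto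
  show ?thesis using 1[OF i(2,3,1)] 2[OF j(2,3,1)] unfolding i(4) j(4) by (cases "val x \<le> val y") auto
qed

text \<open>\<open>g k\<close> lives on slopes modulo \<open>\<pi>^(n - 2 * k)\<close> and sums to zero over each fibre of the reduction modulo
  \<open>\<pi>^(n - 2 * k - 1)\<close>, so that the leaves of level \<open>k\<close> cancel on \<open>P (k + 1) \<times> P (k + 1)\<close>.\<close>

definition balanced_family :: "nat \<Rightarrow> (nat \<Rightarrow> 'a \<Rightarrow> complex) \<Rightarrow> bool" where
  "balanced_family h g \<longleftrightarrow> (\<forall>k. 2 * k < n \<longrightarrow> (\<forall>r \<in> carrier R. g k r ^ h = 1 \<and>
     (\<forall>r' \<in> carrier R. r \<ominus> r' \<in> P (n - 2 * k) \<longrightarrow> g k r = g k r') \<and>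
     (\<Sum>t \<in> carrier R. g k (r \<oplus> \<pi> [^] (n - 2 * k - 1) \<otimes> t)) = 0))"

text \<open>Every slope modulo \<open>\<pi>^(n - 2 * k)\<close> is counted once for each of its \<open>card (P (n - 2 * k))\<close> lifts to the ring,
  whence the normalisation.\<close>

definition balanced_sum :: "(nat \<Rightarrow> 'a \<Rightarrow> complex) \<Rightarrow> nat \<Rightarrow> 'a \<times> 'a \<Rightarrow> complex" where
  "balanced_sum g e p = (\<Sum>k | 2 * k + e < n. 1 / of_nat (card (P (n - 2 * k))) *
     (\<Sum>r \<in> P e. g k r * of_bool (p \<in> leaf k r)))"

text \<open>By \<open>leaf_sum_balanced\<close> only the level \<open>k = val x\<close> can
  contribute, and there the normalisation leaves a single value of \<open>g k\<close>.\<close>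

lemma balanced_sum_value:
  assumes x: "x \<in> carrier R" and y: "y \<in> carrier R"
    and g: "balanced_family h g"
  obtains z where "z ^ h = 1" "balanced_sum g e (x, y) = (if 2 * val x + e < n \<and> val x + e \<le> val y then z else 0)"
proof -
  have root: "g k r ^ h = 1" and zero: "(\<Sum>t \<in> carrier R. g k (r \<oplus> \<pi> [^] (n - 2 * k - 1) \<otimes> t)) = 0"
    if "2 * k < n" "r \<in> carrier R" for k r
    using g that unfolding balanced_family_def by blast+
  have const: "g k r = g k r'"
    if "2 * k < n" "r \<in> carrier R" "r' \<in> carrier R" "r \<ominus> r' \<in> P (n - 2 * k)" for k r r'
    using g that unfolding balanced_family_def by blast
  have c0: "card (P i) \<noteq> 0" for i
  proof -
    have "P i \<noteq> {}" using P_zero[of i] by blast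
    then show ?thesis using finite_P[of i] by simp
  qed
  have "\<forall>k. \<exists>r0. 2 * k + e < n \<longrightarrow> r0 \<in> carrier R \<and> (\<Sum>r \<in> P e. g k r * of_bool ((x, y) \<in> leaf k r)) =
    (if val x = k \<and> k + e \<le> val y then of_nat (card (P (n - 2 * k))) * g k r0 else 0)"
  proof
    fix k
    show "\<exists>r0. 2 * k + e < n \<longrightarrow> r0 \<in> carrier R \<and> (\<Sum>r \<in> P e. g k r * of_bool ((x, y) \<in> leaf k r)) =
      (if val x = k \<and> k + e \<le> val y then of_nat (card (P (n - 2 * k))) * g k r0 else 0)"
    proof (cases "2 * k + e < n")
      case True
      then have k: "2 * k < n" by simp
      have "\<exists>r0 \<in> carrier R. (\<Sum>r \<in> P e. g k r * of_bool ((x, y) \<in> leaf k r)) =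
        (if val x = k \<and> k + e \<le> val y then of_nat (card (P (n - 2 * k))) * g k r0 else 0)"
        by (rule leaf_sum_balanced[where g = "g k", OF x y True const[OF k] zero[OF k]])
      then show ?thesis by (elim bexE) (intro exI impI conjI)
    qed simp
  qed
  from choice[OF this] obtain r0 where "\<forall>k. 2 * k + e < n \<longrightarrow> r0 k \<in> carrier R \<and> (\<Sum>r \<in> P e. g k r * of_bool ((x, y) \<in> leaf k r)) =
    (if val x = k \<and> k + e \<le> val y then of_nat (card (P (n - 2 * k))) * g k (r0 k) else 0)" by (rule exE)
  then have r0: "r0 k \<in> carrier R" "(\<Sum>r \<in> P e. g k r * of_bool ((x, y) \<in> leaf k r)) =
    (if val x = k \<and> k + e \<le> val y then of_nat (card (P (n - 2 * k))) * g k (r0 k) else 0)"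
    if "2 * k + e < n" for k
    using that by (simp_all only: simp_thms)
  have fin: "finite {k. 2 * k + e < n}" by (rule finite_subset[of _ "{..n}"]) auto
  have "balanced_sum g e (x, y) = (\<Sum>k | 2 * k + e < n. if k = val x then (if val x + e \<le> val y then g k (r0 k) else 0) else 0)"
    unfolding balanced_sum_def by (rule sum.cong) (auto simp: r0 c0)
  also have "\<dots> = (if 2 * val x + e < n \<and> val x + e \<le> val y then g (val x) (r0 (val x)) else 0)"
    using fin by (simp add: sum.delta)
  finally have eq: "balanced_sum g e (x, y) = \<dots>" .
  show ?thesis
  proof (cases "2 * val x + e < n")
    case True
    then show ?thesis using eq root r0(1) by (intro that[of "g (val x) (r0 (val x))"]) simp_all
  \<comment> \<open>The sum is zero here; 1 is a placeholder root of unity.\<close>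
  qed (use eq that[of 1] in simp)
qed

text \<open>Vectors with \<open>val x \<le> val y\<close> and \<open>2 * val x < n\<close> are
  served by the first sum, those with \<open>val y < val x\<close> and
  \<open>2 * val y + 1 < n\<close> by the second, and all others by the last leaf, for both parities
  of \<open>n\<close>. At every vector the other two summands vanish.\<close>

lemma unimodular_balanced_sum:
  assumes x: "x \<in> carrier R" and y: "y \<in> carrier R"
    and g: "balanced_family h g"
  shows "(balanced_sum g 0 (x, y) + balanced_sum g 1 (y, x) + of_bool ((y, x) \<in> leaf (n div 2) \<zero>)) ^ h = 1"
proof -
  obtain z where z: "z ^ h = 1" "balanced_sum g 0 (x, y) = (if 2 * val x + 0 < n \<and> val x + 0 \<le> val y then z else 0)"
    by (rule balanced_sum_value[where e = 0, OF x y g])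
  note z = z[unfolded add_0_right]
  obtain w where w: "w ^ h = 1" "balanced_sum g 1 (y, x) = (if 2 * val y + 1 < n \<and> val y + 1 \<le> val x then w else 0)"
    by (rule balanced_sum_value[where e = 1, OF y x g])
  have "x \<ominus> \<zero> \<otimes> y = x" using x y by (simp add: minus_eq)
  \<comment> \<open>Slope zero makes this leaf the product of \<open>P (n div 2)\<close> and
    \<open>P (n - n div 2)\<close>.\<close>
  then have leaf: "(y, x) \<in> leaf (n div 2) \<zero> \<longleftrightarrow> n div 2 \<le> val y \<and> n - n div 2 \<le> val x"
    using in_P_iff[OF y, of "n div 2"] in_P_iff[OF x, of "n - n div 2"] x by (simp add: leaf_def)
  consider "2 * val x < n" "val x \<le> val y" | "2 * val y + 1 < n" "val y + 1 \<le> val x"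
    | "\<not> (2 * val x < n \<and> val x \<le> val y)" "\<not> (2 * val y + 1 < n \<and> val y + 1 \<le> val x)" by blast
  then show ?thesis
  proof cases
    case 1
    then have "\<not> (n div 2 \<le> val y \<and> n - n div 2 \<le> val x)" "\<not> (2 * val y + 1 < n \<and> val y + 1 \<le> val x)" by linarith+
    moreover from this leaf have "(y, x) \<notin> leaf (n div 2) \<zero>" by blast
    ultimately show ?thesis using 1 z w by simp
  next
    case 2
    then have "\<not> (n div 2 \<le> val y \<and> n - n div 2 \<le> val x)" "\<not> (2 * val x < n \<and> val x \<le> val y)" by linarith+
    moreover from this leaf have "(y, x) \<notin> leaf (n div 2) \<zero>" by blast
    ultimately show ?thesis using 2 z w by simp
  next
    case 3
    then have "n div 2 \<le> val y \<and> n - n div 2 \<le> val x" by linarith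
    then have "(y, x) \<in> leaf (n div 2) \<zero>" using leaf by blast
    moreover have "balanced_sum g 0 (x, y) = 0" "balanced_sum g 1 (y, x) = 0"
      by (simp_all only: z(2) w(2) if_not_P[OF 3(1)] if_not_P[OF 3(2)])
    ultimately show ?thesis by simp
  qed
qed

section \<open>Lifting a balanced function from the residue field\<close>

lemma add_neg_cancel: "a \<in> carrier R \<Longrightarrow> b \<in> carrier R \<Longrightarrow> a \<oplus> (b \<oplus> \<ominus> a) = b"
  by (subst a_lcomm) (simp_all add: r_neg)

text \<open>The lift evaluates \<open>E\<close> at the digit of \<open>r\<close> belonging to
  \<open>\<pi> [^] l\<close>. Adding \<open>\<pi> [^] l \<otimes> t\<close> shifts this digit by
  \<open>t\<close>, so the sum over \<open>t\<close> becomes the full sum of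
  \<open>E\<close>.\<close>

lemma lift_balanced:
  fixes E :: "'a \<Rightarrow> complex"
  assumes root: "\<And>r. r \<in> carrier R \<Longrightarrow> E r ^ h = 1"
    and const: "\<And>r r'. r \<in> carrier R \<Longrightarrow> r' \<in> carrier R \<Longrightarrow> r \<ominus> r' \<in> P 1 \<Longrightarrow> E r = E r'"
    and zero: "(\<Sum>r \<in> carrier R. E r) = 0"
    and l: "l < n"
  shows "\<exists>g :: 'a \<Rightarrow> complex. \<forall>r \<in> carrier R. g r ^ h = 1 \<and>
    (\<forall>r' \<in> carrier R. r \<ominus> r' \<in> P (l + 1) \<longrightarrow> g r = g r') \<and>
    (\<Sum>t \<in> carrier R. g (r \<oplus> \<pi> [^] l \<otimes> t)) = 0"
proof -
  define \<rho> where "\<rho> r = (SOME s. s \<in> carrier R \<and> r \<ominus> s \<in> P l)" for r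
  \<comment> \<open>The digit is determined only up to \<open>P (n - l)\<close>; this lies in
    \<open>P 1\<close> because \<open>l < n\<close>, and \<open>E\<close> does not separate elements
    congruent modulo \<open>P 1\<close>.\<close>
  define \<tau> where "\<tau> r = (SOME t. t \<in> carrier R \<and> r \<ominus> \<rho> r = \<pi> [^] l \<otimes> t)" for r
  have rho: "\<rho> r \<in> carrier R \<and> r \<ominus> \<rho> r \<in> P l" if "r \<in> carrier R" for r
    unfolding \<rho>_def by (rule someI[of _ r]) (use that in \<open>simp add: minus_eq r_neg\<close>)
  have tau: "\<tau> r \<in> carrier R \<and> r \<ominus> \<rho> r = \<pi> [^] l \<otimes> \<tau> r" if r: "r \<in> carrier R" for r
    unfolding \<tau>_def by (rule someI_ex) (use rho[OF r] in \<open>auto elim: P_E\<close>)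
  have rho_cong: "\<rho> r = \<rho> r'" if r: "r \<in> carrier R" "r' \<in> carrier R" "r \<ominus> r' \<in> P l" for r r'
  proof -
    have "r \<ominus> s \<in> P l \<longleftrightarrow> r' \<ominus> s \<in> P l" if s: "s \<in> carrier R" for s
    proof -
      have "r \<ominus> s = (r \<ominus> r') \<oplus> (r' \<ominus> s)" "r' \<ominus> s = (r \<ominus> s) \<ominus> (r \<ominus> r')"
        using r(1,2) s by (simp_all add: minus_eq minus_add a_ac r_neg1 r_neg2)
      then show ?thesis using P_add[OF r(3)] P_minus[OF _ r(3)] by metis
    qed
    \<comment> \<open>Congruent elements impose equivalent conditions, so the choice operator
      returns the same representative.\<close>
    then show ?thesis unfolding \<rho>_def by (metis (no_types, lifting))
  qed
  have pow_cancel: "t \<ominus> t' \<in> P 1" if "t \<in> carrier R" "t' \<in> carrier R" "\<pi> [^] l \<otimes> t \<ominus> \<pi> [^] l \<otimes> t' \<in> P (l + 1)" for t t'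
  proof -
    have "\<pi> [^] l \<otimes> (t \<ominus> t') = \<pi> [^] l \<otimes> t \<ominus> \<pi> [^] l \<otimes> t'" using that by (simp add: minus_eq r_distr r_minus)
    then show ?thesis using pow_mult_in_P[of "t \<ominus> t'" l "l + 1"] that l by simp
  qed
  show ?thesis
  proof (intro exI[of _ "\<lambda>r. E (\<tau> r)"] ballI conjI impI)
    show "E (\<tau> r) ^ h = 1" if "r \<in> carrier R" for r using root tau[OF that] by simp
  next
    fix r r' assume r: "r \<in> carrier R" "r' \<in> carrier R" "r \<ominus> r' \<in> P (l + 1)"
    have "r \<ominus> r' \<in> P l" using r P_antimono[of l "l + 1"] by auto
    then have eq: "\<rho> r = \<rho> r'" using rho_cong r by blast
    have "\<pi> [^] l \<otimes> \<tau> r \<ominus> \<pi> [^] l \<otimes> \<tau> r' = (r \<ominus> \<rho> r) \<ominus> (r' \<ominus> \<rho> r)" using tau[OF r(1)] tau[OF r(2)] eq by simp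
    also have "\<dots> = r \<ominus> r'" using r(1,2) rho[OF r(1)] by (simp add: minus_eq minus_add a_ac add_neg_cancel)
    finally show "E (\<tau> r) = E (\<tau> r')" using const pow_cancel tau r by metis
  next
    fix r assume r: "r \<in> carrier R"
    define t0 where "t0 = \<tau> r"
    have t0: "t0 \<in> carrier R" "r \<ominus> \<rho> r = \<pi> [^] l \<otimes> t0" using tau[OF r] by (auto simp: t0_def)
    have "E (\<tau> (r \<oplus> \<pi> [^] l \<otimes> t)) = E (t0 \<oplus> t)" if t: "t \<in> carrier R" for t
    proof -
      let ?r = "r \<oplus> \<pi> [^] l \<otimes> t"
      have R: "?r \<in> carrier R" using r t by simp
      have "?r \<ominus> r = \<pi> [^] l \<otimes> t" using r t by (simp add: minus_eq a_ac r_neg1 r_neg2)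
      then have "?r \<ominus> r \<in> P l" using P_I[OF t] by simp
      then have eq: "\<rho> ?r = \<rho> r" using rho_cong[OF R r] by blast
      have "\<pi> [^] l \<otimes> \<tau> ?r = ?r \<ominus> \<rho> r" using tau[OF R] eq by simp
      also have "\<dots> = (r \<ominus> \<rho> r) \<oplus> \<pi> [^] l \<otimes> t" using r t rho[OF r] by (simp add: minus_eq a_ac)
      also have "\<dots> = \<pi> [^] l \<otimes> (t0 \<oplus> t)" using t0 t by (simp add: r_distr)
      finally have "\<pi> [^] l \<otimes> \<tau> ?r \<ominus> \<pi> [^] l \<otimes> (t0 \<oplus> t) \<in> P (l + 1)" using t0 t by (simp add: minus_eq r_neg)
      then show ?thesis using const pow_cancel tau[OF R] t0 t by simp
    qed
    then have "(\<Sum>t \<in> carrier R. E (\<tau> (r \<oplus> \<pi> [^] l \<otimes> t))) = (\<Sum>t \<in> carrier R. E (t0 \<oplus> t))" by simp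
    also have "\<dots> = (\<Sum>t \<in> carrier R. E t)"
    proof (rule sum.reindex_bij_betw)
      have inj: "inj_on (\<lambda>t. t0 \<oplus> t) (carrier R)" using t0 by (auto simp: inj_on_def)
      moreover have "(\<lambda>t. t0 \<oplus> t) ` carrier R \<subseteq> carrier R" using t0 by auto
      ultimately show "bij_betw (\<lambda>t. t0 \<oplus> t) (carrier R) (carrier R)"
        unfolding bij_betw_def using endo_inj_surj[OF finite_carrier] by blast
    qed
    finally show "(\<Sum>t \<in> carrier R. E (\<tau> (r \<oplus> \<pi> [^] l \<otimes> t))) = 0" using zero by simp
  qed
qed

subsection \<open>Residue representatives and digits\<close>

lemma abelian_subgroup_P: "abelian_subgroup (P k) R"
  using abelian_subgroupI3[OF _ abelian_group_axioms] P_ideal ideal.axioms(1) by blast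

lemma lcoset_P: "x \<in> carrier R \<Longrightarrow> x <+ P k = {r \<in> carrier R. r \<ominus> x \<in> P k}"
proof (intro equalityI subsetI)
  fix r assume x: "x \<in> carrier R" and "r \<in> x <+ P k"
  then obtain z where z: "z \<in> P k" "r = x \<oplus> z" by (auto simp: a_l_coset_def')
  then have "r \<ominus> x = z" using x P_closed[OF z(1)] by (simp add: minus_eq a_assoc add_neg_cancel)
  then show "r \<in> {r \<in> carrier R. r \<ominus> x \<in> P k}" using x z P_closed[OF z(1)] by simp
next
  fix r assume x: "x \<in> carrier R" and "r \<in> {r \<in> carrier R. r \<ominus> x \<in> P k}"
  then have r: "r \<in> carrier R" "r \<ominus> x \<in> P k" by auto
  then have "r = x \<oplus> (r \<ominus> x)" using x by (simp add: minus_eq add_neg_cancel)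
  then show "r \<in> x <+ P k" using r unfolding a_l_coset_def' by blast
qed

lemma diff_commute_P: "x \<in> carrier R \<Longrightarrow> y \<in> carrier R \<Longrightarrow> x \<ominus> y \<in> P k \<Longrightarrow> y \<ominus> x \<in> P k"
  using P_minus[OF P_zero, of "x \<ominus> y" k] by (simp add: minus_eq minus_add a_comm)

lemma diff_trans_P:
  "x \<in> carrier R \<Longrightarrow> y \<in> carrier R \<Longrightarrow> z \<in> carrier R \<Longrightarrow> x \<ominus> y \<in> P k \<Longrightarrow> y \<ominus> z \<in> P k \<Longrightarrow> x \<ominus> z \<in> P k"
  using P_add[of "x \<ominus> y" k "y \<ominus> z"] by (simp add: minus_eq a_assoc r_neg1)

lemma lcoset_P_cong:
  assumes "x \<in> carrier R" "u \<in> carrier R" "x \<ominus> u \<in> P k"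
  shows "{r \<in> carrier R. x \<ominus> r \<in> P k} = u <+ P k"
  unfolding lcoset_P[OF assms(2)]
  using assms diff_commute_P diff_trans_P by (intro Collect_cong) blast

context
  fixes T :: "'a set"
  assumes T: "coset_representatives R (P 1) T" and zero_T: "\<zero> \<in> T"
begin

lemma T_closed: "t \<in> T \<Longrightarrow> t \<in> carrier R"
  using T by (auto simp: coset_representatives_def)

lemma representative_exists:
  assumes r: "r \<in> carrier R"
  obtains t where "t \<in> T" "r \<ominus> t \<in> P 1"
proof -
  interpret abelian_subgroup "P 1" R by (rule abelian_subgroup_P)
  have "P 1 +> r \<in> a_rcosets (P 1)" using r by (intro a_rcosetsI) auto
  then obtain t where t: "t \<in> T" "t \<in> P 1 +> r" using T unfolding coset_representatives_def by blast
  then have "t \<ominus> r \<in> P 1" using a_rcos_module_minus[OF ring_axioms r] T_closed by simp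
  then show ?thesis using that t diff_commute_P r T_closed by blast
qed

lemma representative_unique:
  assumes "s \<in> T" "t \<in> T" "s \<ominus> t \<in> P 1"
  shows "s = t"
proof -
  interpret abelian_subgroup "P 1" R by (rule abelian_subgroup_P)
  have st: "s \<in> carrier R" "t \<in> carrier R" using assms T_closed by auto
  have "P 1 +> t \<in> a_rcosets (P 1)" using st by (intro a_rcosetsI) auto
  moreover have "s \<in> P 1 +> t" using a_rcos_module_minus[OF ring_axioms st(2,1)] assms by simp
  moreover have "t \<in> P 1 +> t" using a_rcos_self st by simp
  ultimately show ?thesis using T assms unfolding coset_representatives_def by blast
qed

lemma digit_set_closed: "digit_set R \<pi> T i \<subseteq> carrier R"
proof (induct i)
  case (Suc i)
  then show ?case using T_closed by (fastforce simp: set_add_def' l_coset_def)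
qed simp

lemma digit_set_SucI: "x \<in> digit_set R \<pi> T i \<Longrightarrow> t \<in> T \<Longrightarrow> x \<oplus> \<pi> [^] i \<otimes> t \<in> digit_set R \<pi> T (Suc i)"
  by (auto simp: set_add_def' l_coset_def)

text \<open>Append the digit zero, available by \<open>zero_T\<close>.\<close>

lemma digit_set_mono: "i \<le> j \<Longrightarrow> digit_set R \<pi> T i \<subseteq> digit_set R \<pi> T j"
proof (induct j rule: dec_induct)
  case (step j)
  have "x \<in> digit_set R \<pi> T (Suc j)" if x: "x \<in> digit_set R \<pi> T j" for x
  proof -
    have "x \<in> carrier R" using x digit_set_closed by blast
    then show ?thesis using digit_set_SucI[OF x zero_T] by (simp del: digit_set.simps)
  qed
  then show ?case using step by blast
qed simp

text \<open>The error after \<open>i\<close> digits is \<open>\<pi> [^] i \<otimes> z\<close>; the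
  representative of \<open>z\<close> modulo \<open>P 1\<close> is the next digit.\<close>

lemma digit_set_cover:
  assumes r: "r \<in> carrier R"
  obtains x where "x \<in> digit_set R \<pi> T i" "r \<ominus> x \<in> P i"
proof -
  have "\<exists>x \<in> digit_set R \<pi> T i. r \<ominus> x \<in> P i"
  proof (induct i)
    case 0
    then show ?case using r by (simp add: minus_eq)
  next
    case (Suc i)
    then obtain x where x: "x \<in> digit_set R \<pi> T i" "r \<ominus> x \<in> P i" by blast
    have xR: "x \<in> carrier R" using x digit_set_closed by blast
    obtain z where z: "z \<in> carrier R" "r \<ominus> x = \<pi> [^] i \<otimes> z" using x(2) by (rule P_E)
    obtain t where t: "t \<in> T" "z \<ominus> t \<in> P 1" using representative_exists[OF z(1)] .
    have tR: "t \<in> carrier R" using T_closed t by simp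
    have "r \<ominus> (x \<oplus> \<pi> [^] i \<otimes> t) = (r \<ominus> x) \<ominus> \<pi> [^] i \<otimes> t"
      using r xR tR by (simp add: minus_eq minus_add a_assoc)
    also have "\<dots> = \<pi> [^] i \<otimes> (z \<ominus> t)" using z tR by (simp add: minus_eq r_distr r_minus)
    also have "\<dots> \<in> P (i + 1)" using P_mult_P[OF P_I[of \<one> i] t(2)] by simp
    finally show ?case using digit_set_SucI[OF x(1) t(1)] by (auto simp del: digit_set.simps)
  qed
  then show ?thesis using that by blast
qed

lemma lmult_iff: "v \<in> \<pi> <# A \<longleftrightarrow> (\<exists>a \<in> A. v = \<pi> \<otimes> a)"
  by (auto simp: l_coset_def)

lemma lmult_subset_P: "A \<subseteq> carrier R \<Longrightarrow> \<pi> <# A \<subseteq> P 1"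
  using P_I[of _ 1] by (auto simp: lmult_iff subset_iff)

lemma sum_over_representatives:
  fixes f :: "'a \<Rightarrow> complex"
  shows "(\<Sum>r \<in> carrier R. f r) = (\<Sum>u \<in> T. \<Sum>r \<in> u <+ P 1. f r)"
proof -
  have "carrier R = (\<Union>u \<in> T. u <+ P 1)"
  proof (intro equalityI subsetI)
    fix r assume r: "r \<in> carrier R"
    then obtain t where "t \<in> T" "r \<ominus> t \<in> P 1" using representative_exists by blast
    then have "r \<in> t <+ P 1" using r T_closed lcoset_P by simp
    then show "r \<in> (\<Union>u \<in> T. u <+ P 1)" using \<open>t \<in> T\<close> by blast
  qed (use T_closed lcoset_P in auto)
  moreover have "(\<Sum>r \<in> (\<Union>u \<in> T. u <+ P 1). f r) = (\<Sum>u \<in> T. \<Sum>r \<in> u <+ P 1. f r)"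
  proof (rule sum.UNION_disjoint)
    show "finite T" using finite_subset[OF _ finite_carrier] T_closed by blast
    show "\<forall>u \<in> T. finite (u <+ P 1)" using lcoset_P T_closed finite_carrier by simp
    show "\<forall>u \<in> T. \<forall>v \<in> T. u \<noteq> v \<longrightarrow> (u <+ P 1) \<inter> (v <+ P 1) = {}"
    proof (intro ballI impI, rule ccontr)
      fix u v assume uv: "u \<in> T" "v \<in> T" "u \<noteq> v" "(u <+ P 1) \<inter> (v <+ P 1) \<noteq> {}"
      then obtain r where "r \<in> carrier R" "r \<ominus> u \<in> P 1" "r \<ominus> v \<in> P 1"
        using lcoset_P T_closed by auto
      then have "u \<ominus> v \<in> P 1" using diff_commute_P diff_trans_P uv T_closed by meson
      then show False using representative_unique uv by blast
    qed
  qed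
  ultimately show ?thesis by simp
qed

lemma sum_over_shifted_representatives:
  fixes f :: "'a \<Rightarrow> complex"
  shows "(\<Sum>s \<in> P 1. f s) = (\<Sum>v \<in> \<pi> <# T. \<Sum>s \<in> v <+ P 2. f s)"
proof -
  have vP1: "v \<in> P 1" if "v \<in> \<pi> <# T" for v
    using lmult_subset_P[OF subsetI[OF T_closed]] that by blast
  note vP = vP1 P_closed[OF vP1]
  have "P 1 = (\<Union>v \<in> \<pi> <# T. v <+ P 2)"
  proof (intro equalityI subsetI)
    fix s assume s: "s \<in> P 1"
    then obtain z where z: "z \<in> carrier R" "s = \<pi> \<otimes> z" by (auto elim: P_E)
    then obtain t where t: "t \<in> T" "z \<ominus> t \<in> P 1" using representative_exists by blast
    have "s \<ominus> \<pi> \<otimes> t = \<pi> \<otimes> (z \<ominus> t)" using z t T_closed by (simp add: minus_eq r_distr r_minus)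
    also have "\<dots> \<in> P 2" using P_mult_P[OF P_I[of \<one> 1] t(2)] by (simp add: numeral_2_eq_2)
    finally have "s \<in> \<pi> \<otimes> t <+ P 2" using lcoset_P[of "\<pi> \<otimes> t" 2] s t T_closed by simp
    then show "s \<in> (\<Union>v \<in> \<pi> <# T. v <+ P 2)" using t lmult_iff by blast
  next
    fix s assume "s \<in> (\<Union>v \<in> \<pi> <# T. v <+ P 2)"
    then obtain v z where v: "v \<in> \<pi> <# T" "z \<in> P 2" "s = v \<oplus> z" by (auto simp: a_l_coset_def')
    then show "s \<in> P 1" using vP P_add P_antimono[of 1 2] by auto
  qed
  moreover have "(\<Sum>s \<in> (\<Union>v \<in> \<pi> <# T. v <+ P 2). f s) = (\<Sum>v \<in> \<pi> <# T. \<Sum>s \<in> v <+ P 2. f s)"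
  proof (rule sum.UNION_disjoint)
    show "finite (\<pi> <# T)" using finite_subset[OF subsetI finite_carrier] vP by blast
    show "\<forall>u \<in> \<pi> <# T. finite (u <+ P 2)" using lcoset_P vP finite_carrier by simp
    show "\<forall>u \<in> \<pi> <# T. \<forall>v \<in> \<pi> <# T. u \<noteq> v \<longrightarrow> (u <+ P 2) \<inter> (v <+ P 2) = {}"
    proof (intro ballI impI, rule ccontr)
      fix u v assume uv: "u \<in> \<pi> <# T" "v \<in> \<pi> <# T" "u \<noteq> v" "(u <+ P 2) \<inter> (v <+ P 2) \<noteq> {}"
      then obtain r where "r \<in> carrier R" "r \<ominus> u \<in> P 2" "r \<ominus> v \<in> P 2"
        using lcoset_P vP by auto
      then have uv2: "u \<ominus> v \<in> P 2" using diff_commute_P diff_trans_P uv vP by meson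
      obtain s t where st: "s \<in> T" "t \<in> T" "u = \<pi> \<otimes> s" "v = \<pi> \<otimes> t" using uv lmult_iff by auto
      have stR: "s \<in> carrier R" "t \<in> carrier R" using st T_closed by auto
      have eq: "u \<ominus> v = \<pi> [^] (1::nat) \<otimes> (s \<ominus> t)" using st stR by (simp add: minus_eq r_distr r_minus)
      \<comment> \<open>Cancelling \<open>\<pi>\<close> modulo \<open>P 2\<close> requires
        \<open>2 \<le> n\<close>. For \<open>n = 1\<close> the ideal \<open>P 1\<close> is zero, so
        there are no two distinct cosets to separate.\<close>
      have "2 \<le> n"
      proof (rule ccontr)
        assume "\<not> 2 \<le> n"
        then have "n = 1" using n_pos by linarith
        then have "u = \<zero>" "v = \<zero>" using vP uv P_n[of 1] by auto
        then show False using uv by simp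
      qed
      then have "s \<ominus> t \<in> P (2 - 1)"
        using pow_mult_in_P[of "s \<ominus> t" 1 2] uv2 stR unfolding eq by simp
      then have "s = t" using representative_unique st by simp
      then show False using st uv by simp
    qed
  qed
  ultimately show ?thesis by simp
qed

lemma lcoset_singleton: "v \<in> carrier R \<Longrightarrow> n \<le> k \<Longrightarrow> v <+ P k = {v}"
  by (simp add: a_l_coset_def' P_n)

text \<open>Every class modulo \<open>P i\<close> has a representative in the digit set, so the
  conditions indexed by digits determine all class sums. Classes modulo \<open>P n\<close> are
  singletons, and there the conditions on the values of \<open>\<epsilon>\<close> and
  \<open>\<mu>\<close> apply. This is the form that \<open>spread_dual_fun\<close> takes.\<close>

lemma root_system_sums:
  assumes rs: "root_system R (P 1) \<pi> T n h \<eta> \<epsilon> \<delta> \<mu> \<gamma>"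
  shows "1 \<le> i \<Longrightarrow> i \<le> n \<Longrightarrow> r \<in> carrier R \<Longrightarrow> (\<Sum>r' \<in> {r' \<in> carrier R. r \<ominus> r' \<in> P i}. \<epsilon> r') ^ h = 1"
    and "1 \<le> i \<Longrightarrow> i \<le> n \<Longrightarrow> s \<in> P 1 \<Longrightarrow> (\<Sum>s' \<in> {s' \<in> P 1. s \<ominus> s' \<in> P i}. \<mu> s') ^ h = 1"
    and "((\<Sum>r \<in> carrier R. \<epsilon> r) + (\<Sum>s \<in> P 1. \<mu> s)) ^ h = 1"
proof -
  have eta: "\<eta> ^ h = 1"
    and eps: "\<And>r. r \<in> carrier R \<Longrightarrow> \<epsilon> r ^ h = 1"
    and delta: "\<And>u. u \<in> digit_set R \<pi> T (n - 1) \<Longrightarrow> \<delta> u ^ h = 1"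
    and mu: "\<And>s. s \<in> P 1 \<Longrightarrow> \<mu> s ^ h = 1"
    and gamma: "\<And>v. v \<in> \<pi> <# digit_set R \<pi> T (n - 2) \<Longrightarrow> \<gamma> v ^ h = 1"
    and eps_sum: "\<And>i u. 1 \<le> i \<Longrightarrow> i < n \<Longrightarrow> u \<in> digit_set R \<pi> T i \<Longrightarrow> (\<Sum>r \<in> u <+ P i. \<epsilon> r) = \<delta> u"
    and mu_sum: "\<And>j v. j + 1 < n \<Longrightarrow> v \<in> \<pi> <# digit_set R \<pi> T j \<Longrightarrow> (\<Sum>s \<in> v <+ P (j + 1). \<mu> s) = \<gamma> v"
    and total: "(\<Sum>u \<in> T. if 2 \<le> n then \<delta> u else \<epsilon> u) + (\<Sum>v \<in> \<pi> <# T. if 3 \<le> n then \<gamma> v else \<mu> v) = \<eta>"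
    using rs unfolding root_system_def P_pow by blast+
  show "(\<Sum>r' \<in> {r' \<in> carrier R. r \<ominus> r' \<in> P i}. \<epsilon> r') ^ h = 1"
    if i: "1 \<le> i" "i \<le> n" and r: "r \<in> carrier R" for i r
  proof (cases "i = n")
    case True
    have "r \<ominus> r \<in> P i" using r by (simp add: minus_eq r_neg)
    then have "{r' \<in> carrier R. r \<ominus> r' \<in> P i} = {r}"
      using lcoset_P_cong[OF r r] lcoset_singleton[OF r] True by simp
    then show ?thesis using eps r by simp
  next
    case False
    obtain u where u: "u \<in> digit_set R \<pi> T i" "r \<ominus> u \<in> P i" using digit_set_cover[OF r] .
    have uR: "u \<in> carrier R" using u digit_set_closed by blast
    have "i \<le> n - 1" using False i by simp
    then have "u \<in> digit_set R \<pi> T (n - 1)" using u digit_set_mono by blast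
    then show ?thesis using lcoset_P_cong[OF r uR u(2)] eps_sum[OF i(1) _ u(1)] False i delta by simp
  qed
  show "(\<Sum>s' \<in> {s' \<in> P 1. s \<ominus> s' \<in> P i}. \<mu> s') ^ h = 1"
    if i: "1 \<le> i" "i \<le> n" and s: "s \<in> P 1" for i s
  proof -
    have sR: "s \<in> carrier R" using s by simp
    have "s' \<in> P 1" if "s' \<in> carrier R" "s \<ominus> s' \<in> P i" for s'
    proof -
      have "s \<ominus> s' \<in> P 1" using that P_antimono[OF i(1)] by blast
      then have "s \<ominus> (s \<ominus> s') \<in> P 1" by (rule P_minus[OF s])
      then show ?thesis using that sR by (simp add: minus_eq minus_add r_neg1 r_neg2)
    qed
    then have eq: "{s' \<in> P 1. s \<ominus> s' \<in> P i} = {s' \<in> carrier R. s \<ominus> s' \<in> P i}" by auto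
    show ?thesis
    proof (cases "i = n")
      case True
      have "s \<ominus> s \<in> P i" using sR by (simp add: minus_eq r_neg)
      then have "{s' \<in> carrier R. s \<ominus> s' \<in> P i} = {s}"
        using lcoset_P_cong[OF sR sR] lcoset_singleton[OF sR] True by simp
      then show ?thesis using mu s eq by simp
    next
      case False
      \<comment> \<open>For \<open>s = \<pi> \<otimes> t\<close>, knowing \<open>s\<close> modulo
        \<open>P i\<close> takes only \<open>i - 1\<close> digits of \<open>t\<close>.\<close>
      define j where "j = i - 1"
      have j: "i = j + 1" "j + 1 < n" using i False by (auto simp: j_def)
      obtain t where t: "t \<in> carrier R" "s = \<pi> \<otimes> t" using s by (auto elim: P_E)
      obtain u where u: "u \<in> digit_set R \<pi> T j" "t \<ominus> u \<in> P j" using digit_set_cover[OF t(1)] .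
      have uR: "u \<in> carrier R" using u digit_set_closed by blast
      have "s \<ominus> \<pi> \<otimes> u = \<pi> \<otimes> (t \<ominus> u)" using t uR by (simp add: minus_eq r_distr r_minus)
      also have "\<dots> \<in> P i" using P_mult_P[OF P_I[of \<one> 1] u(2)] j by simp
      finally have su: "s \<ominus> \<pi> \<otimes> u \<in> P i" .
      have "j \<le> n - 2" using j by simp
      then have v: "\<pi> \<otimes> u \<in> \<pi> <# digit_set R \<pi> T j" "\<pi> \<otimes> u \<in> \<pi> <# digit_set R \<pi> T (n - 2)"
        using u digit_set_mono[of j "n - 2"] lmult_iff by blast+
      show ?thesis
        using lcoset_P_cong[OF sR _ su] uR mu_sum[OF j(2) v(1)] gamma[OF v(2)] unfolding eq unfolding j(1) by simp
    qed
  qed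
  have "(\<Sum>r \<in> u <+ P 1. \<epsilon> r) = (if 2 \<le> n then \<delta> u else \<epsilon> u)" if u: "u \<in> T" for u
  proof (cases "2 \<le> n")
    case True
    have "u \<in> digit_set R \<pi> T 1" using digit_set_SucI[of \<zero> 0 u] u T_closed by (simp del: digit_set.simps(2))
    then show ?thesis using True eps_sum[of 1 u] by simp
  next
    case False
    then show ?thesis using lcoset_singleton[of u 1] u T_closed by simp
  qed
  moreover have "(\<Sum>s \<in> v <+ P 2. \<mu> s) = (if 3 \<le> n then \<gamma> v else \<mu> v)" if v: "v \<in> \<pi> <# T" for v
  proof (cases "3 \<le> n")
    case True
    have "T \<subseteq> digit_set R \<pi> T 1"
      using digit_set_SucI[of \<zero> 0] T_closed by (auto simp del: digit_set.simps(2))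
    then have "v \<in> \<pi> <# digit_set R \<pi> T 1" using v lmult_iff by blast
    then show ?thesis using True mu_sum[of 1 v] by (simp add: numeral_2_eq_2)
  next
    case False
    have "v \<in> carrier R" using v T_closed lmult_iff by auto
    then show ?thesis using False lcoset_singleton[of v 2] by simp
  qed
  ultimately show "((\<Sum>r \<in> carrier R. \<epsilon> r) + (\<Sum>s \<in> P 1. \<mu> s)) ^ h = 1"
    unfolding sum_over_representatives sum_over_shifted_representatives using total eta by simp
qed

end

text \<open>An enumeration of the cosets distributes the values \<open>f i\<close>; all cosets have
  the same size, so the total is a multiple of a vanishing sum.\<close>

lemma balanced_residue_function:
  fixes f :: "nat \<Rightarrow> complex"
  assumes N: "card (a_rcosets (P 1)) = N" and root: "\<And>i. f i ^ h = 1" and zero: "(\<Sum>i<N. f i) = 0"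
  shows "\<exists>E :: 'a \<Rightarrow> complex. (\<forall>r. E r ^ h = 1) \<and>
    (\<forall>r \<in> carrier R. \<forall>r' \<in> carrier R. r \<ominus> r' \<in> P 1 \<longrightarrow> E r = E r') \<and> (\<Sum>r \<in> carrier R. E r) = 0"
proof -
  interpret abelian_subgroup "P 1" R by (rule abelian_subgroup_P)
  have fin: "finite (a_rcosets (P 1))"
    using a_rcosets_part_G finite_carrier finite_UnionD by metis
  then obtain \<beta> where \<beta>: "bij_betw \<beta> (a_rcosets (P 1)) {..<N}"
    using finite_same_card_bij[of "a_rcosets (P 1)" "{..<N}"] N by auto
  define E where "E r = f (\<beta> (P 1 +> r))" for r
  have const: "E r = f (\<beta> C)" if "C \<in> a_rcosets (P 1)" "r \<in> C" for r C
  proof -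
    obtain x where x: "x \<in> carrier R" "C = P 1 +> x" using \<open>C \<in> a_rcosets (P 1)\<close> unfolding A_RCOSETS_def' by blast
    then show ?thesis using a_repr_independence'[of r x] that by (simp add: E_def)
  qed
  show ?thesis
  proof (intro exI[of _ E] conjI allI ballI impI)
    show "E r ^ h = 1" for r using root by (simp add: E_def)
    show "E r = E r'" if r: "r \<in> carrier R" "r' \<in> carrier R" "r \<ominus> r' \<in> P 1" for r r'
    proof -
      have "r \<in> P 1 +> r'" using r a_rcos_module_minus[OF ring_axioms] by simp
      then show ?thesis using a_repr_independence'[of r r'] r by (simp add: E_def)
    qed
    have "(\<Sum>r \<in> carrier R. E r) = (\<Sum>r \<in> \<Union> (a_rcosets (P 1)). E r)" by (simp only: a_rcosets_part_G)
    also have "\<dots> = (\<Sum>C \<in> a_rcosets (P 1). \<Sum>r \<in> C. E r)"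
      using a_cosets_finite[OF _ a_subset finite_carrier] a_rcos_disjoint
      by (subst sum.Union_disjoint) (auto simp: pairwise_def disjnt_def)
    also have "\<dots> = (\<Sum>C \<in> a_rcosets (P 1). of_nat (card (P 1)) * f (\<beta> C))"
    proof (rule sum.cong[OF refl])
      fix C assume C: "C \<in> a_rcosets (P 1)"
      have "card C = card (P 1)" using a_card_cosets_equal[OF C] finite_carrier P_closed by blast
      then show "(\<Sum>r \<in> C. E r) = of_nat (card (P 1)) * f (\<beta> C)" using const[OF C] by simp
    qed
    also have "\<dots> = of_nat (card (P 1)) * (\<Sum>i<N. f i)"
      using sum.reindex_bij_betw[OF \<beta>, of f] by (simp add: sum_distrib_left[symmetric])
    finally show "(\<Sum>r \<in> carrier R. E r) = 0" using zero by simp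
  qed
qed

subsection \<open>The additive group\<close>

lemma prime_power_multiple:
  fixes p m c :: nat
  assumes u: "u \<in> Units R" and p: "[p] \<cdot>\<^bsub>R\<^esub> \<one> = \<pi> [^] m \<otimes> u" and x: "x \<in> carrier R"
  shows "[(p ^ c)] \<cdot>\<^bsub>R\<^esub> x = \<pi> [^] (c * m) \<otimes> (u [^] c \<otimes> x)"
proof (induct c)
  case 0
  then show ?case using x by simp
next
  case (Suc c)
  have uR: "u \<in> carrier R" by (rule Units_closed[OF u])
  define y where "y = \<pi> [^] (c * m) \<otimes> (u [^] c \<otimes> x)"
  have y: "y \<in> carrier R" using uR x by (simp add: y_def)
  have "[(p ^ Suc c)] \<cdot>\<^bsub>R\<^esub> x = [p] \<cdot>\<^bsub>R\<^esub> ([(p ^ c)] \<cdot>\<^bsub>R\<^esub> x)"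
    using x by (simp add: add.nat_pow_pow mult.commute)
  also have "\<dots> = ([p] \<cdot>\<^bsub>R\<^esub> \<one>) \<otimes> y" using add_pow_ldistr[of \<one> y p] y Suc by (simp add: y_def)
  also have "\<dots> = (\<pi> [^] m \<otimes> \<pi> [^] (c * m)) \<otimes> (u [^] c \<otimes> u \<otimes> x)"
    using uR x by (simp add: p y_def m_ac)
  also have "\<pi> [^] m \<otimes> \<pi> [^] (c * m) = \<pi> [^] (Suc c * m)" by (simp add: nat_pow_mult)
  finally show ?case by simp
qed

text \<open>Up to a unit, \<open>p ^ c\<close> acts as \<open>\<pi> [^] (c * m)\<close>, which
  pushes \<open>\<pi> [^] i \<otimes> x\<close> into the zero ideal \<open>P n\<close>.\<close>

lemma prime_power_torsion:
  fixes p m c i :: nat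
  assumes u: "u \<in> Units R" and p: "[p] \<cdot>\<^bsub>R\<^esub> \<one> = \<pi> [^] m \<otimes> u" and x: "x \<in> carrier R"
    and le: "n \<le> c * m + i"
  shows "[(p ^ c)] \<cdot>\<^bsub>R\<^esub> (\<pi> [^] i \<otimes> x) = \<zero>"
proof -
  have uR: "u \<in> carrier R" by (rule Units_closed[OF u])
  have "[(p ^ c)] \<cdot>\<^bsub>R\<^esub> (\<pi> [^] i \<otimes> x) = \<pi> [^] (c * m) \<otimes> (u [^] c \<otimes> (\<pi> [^] i \<otimes> x))"
    using prime_power_multiple[OF u p, of "\<pi> [^] i \<otimes> x" c] x by simp
  also have "\<dots> = (\<pi> [^] (c * m) \<otimes> \<pi> [^] i) \<otimes> (u [^] c \<otimes> x)" using uR x by (simp add: m_ac)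
  also have "\<dots> = \<pi> [^] (c * m + i) \<otimes> (u [^] c \<otimes> x)" by (simp add: nat_pow_mult)
  also have "\<dots> \<in> P (c * m + i)" using uR x by (intro P_I) simp
  finally show ?thesis using P_n[OF le] by simp
qed

text \<open>The products \<open>\<pi>^i e\<close> with \<open>i < m\<close> generate the ideals \<open>P k\<close>, from \<open>P n = 0\<close> upwards: with
  \<open>k = c m + i\<close>, the generator \<open>\<pi>^k\<close> is \<open>p^c \<pi>^i\<close> up to a unit.\<close>

lemma additive_generation:
  fixes p m :: nat
  assumes m: "0 < m" and u: "u \<in> Units R" and p: "[p] \<cdot>\<^bsub>R\<^esub> \<one> = \<pi> [^] m \<otimes> u"
    and es: "set es \<subseteq> carrier R"
    and span: "\<And>S. subgroup S (add_monoid R) \<Longrightarrow> P 1 \<subseteq> S \<Longrightarrow> set es \<subseteq> S \<Longrightarrow> S = carrier R"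
    and S: "subgroup S (add_monoid R)" and gen: "\<And>i e. i < m \<Longrightarrow> e \<in> set es \<Longrightarrow> \<pi> [^] i \<otimes> e \<in> S"
  shows "S = carrier R"
proof -
  interpret S: additive_subgroup S R using S by (rule additive_subgroupI)
  have uR: "u \<in> carrier R" "inv u \<in> carrier R" using Units_closed[OF u] Units_inv_closed[OF u] by auto
  have smult: "[k] \<cdot>\<^bsub>R\<^esub> x \<in> S" if "x \<in> S" for x and k :: nat
    using that S.a_Hcarr[OF that] by (induct k) simp_all
  have "P k \<subseteq> S" if "k \<le> n" for k
    using that
  proof (induct k rule: inc_induct)
    case base
    then show ?case by (simp add: P_n)
  next
    case (step k)
    define c where "c = k div m"
    define i where "i = k mod m"
    have k: "c * m + i = k" "i < m" using m by (simp_all add: c_def i_def)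
    \<comment> \<open>Multiplication by \<open>t\<close> is multiplication by
      \<open>\<pi> [^] i\<close> followed by \<open>p ^ c\<close>, so it sends \<open>es\<close>
      into \<open>S\<close>.\<close>
    define t where "t = \<pi> [^] k \<otimes> u [^] c"
    have t: "t \<in> carrier R" using uR by (simp add: t_def)
    have t_eq: "t \<otimes> x = [(p ^ c)] \<cdot>\<^bsub>R\<^esub> (\<pi> [^] i \<otimes> x)" if x: "x \<in> carrier R" for x
    proof -
      have "[(p ^ c)] \<cdot>\<^bsub>R\<^esub> (\<pi> [^] i \<otimes> x) = \<pi> [^] (c * m) \<otimes> (u [^] c \<otimes> (\<pi> [^] i \<otimes> x))"
        using prime_power_multiple[OF u p, of "\<pi> [^] i \<otimes> x" c] x by simp
      also have "\<dots> = (\<pi> [^] (c * m) \<otimes> \<pi> [^] i) \<otimes> (u [^] c \<otimes> x)" using uR x by (simp add: m_ac)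
      also have "\<pi> [^] (c * m) \<otimes> \<pi> [^] i = \<pi> [^] k" using k by (simp add: nat_pow_mult)
      finally show ?thesis using uR x by (simp add: t_def m_assoc)
    qed
    \<comment> \<open>\<open>S'\<close> contains \<open>P 1\<close>, since \<open>t\<close> maps it
      into \<open>P (Suc k)\<close>, already known to lie in \<open>S\<close>; it also contains
      \<open>es\<close>, so \<open>span\<close> makes it the whole ring.\<close>
    define S' where "S' = {y \<in> carrier R. t \<otimes> y \<in> S}"
    have "S' = carrier R"
    proof (rule span)
      show "subgroup S' (add_monoid R)"
      proof (rule add.subgroupI)
        show "S' \<noteq> {}" using t by (auto simp: S'_def intro: exI[of _ \<zero>])
        show "\<ominus> x \<in> S'" if "x \<in> S'" for x
          using that t S.a_inv_closed[of "t \<otimes> x"] by (simp add: S'_def r_minus)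
        show "x \<oplus> y \<in> S'" if "x \<in> S'" "y \<in> S'" for x y
          using that t S.a_closed[of "t \<otimes> x" "t \<otimes> y"] by (simp add: S'_def r_distr)
      qed (auto simp: S'_def)
      show "P 1 \<subseteq> S'"
      proof
        fix x assume x: "x \<in> P 1"
        have "t \<in> P k" using uR by (simp add: t_def P_I)
        then have "t \<otimes> x \<in> P (Suc k)" using P_mult_P[OF _ x] by simp
        then show "x \<in> S'" using step P_closed[OF x] by (auto simp: S'_def)
      qed
      show "set es \<subseteq> S'"
      proof
        fix e assume e: "e \<in> set es"
        then have "e \<in> carrier R" using es by blast
        then show "e \<in> S'" using t_eq smult[OF gen[OF k(2) e]] by (simp add: S'_def)
      qed
    qed
    show ?case
    proof
      fix x assume "x \<in> P k"
      then obtain z where z: "z \<in> carrier R" "x = \<pi> [^] k \<otimes> z" by (rule P_E)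
      \<comment> \<open>Undoing the unit in \<open>t\<close> turns multiples of
        \<open>\<pi> [^] k\<close> into multiples of \<open>t\<close>.\<close>
      have "u [^] c \<otimes> (inv u [^] c \<otimes> z) = (u \<otimes> inv u) [^] c \<otimes> z"
        using uR z by (simp add: nat_pow_distrib m_assoc)
      then have "u [^] c \<otimes> (inv u [^] c \<otimes> z) = z" using u z by simp
      then have "x = t \<otimes> (inv u [^] c \<otimes> z)" using uR z by (simp add: t_def m_assoc)
      moreover have "inv u [^] c \<otimes> z \<in> S'" using \<open>S' = carrier R\<close> uR z by simp
      ultimately show "x \<in> S" by (simp add: S'_def)
    qed
  qed
  then have "carrier R \<subseteq> S" using P_0 by (metis le0)
  then show ?thesis using S.a_subset by blast
qed

section \<open>The additive group of the plane\<close>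

abbreviation plane_group :: "('a \<times> 'a) monoid" where
  "plane_group \<equiv> add_monoid R \<times>\<times> add_monoid R"

lemma carrier_plane_group: "carrier plane_group = V"
  by (simp add: V_def)

lemma one_plane_group: "\<one>\<^bsub>plane_group\<^esub> = (\<zero>, \<zero>)"
  by simp

lemma mult_plane_group: "x \<otimes>\<^bsub>plane_group\<^esub> y = padd x y"
  by (simp add: mult_DirProd' padd_def)

lemma comm_group_plane: "comm_group plane_group"
proof -
  interpret G: group plane_group by (rule DirProd_group) (rule add.is_group)+
  show ?thesis
    by (rule G.group_comm_groupI) (auto simp: a_comm)
qed

lemma pow_plane_group: "x \<in> carrier R \<Longrightarrow> y \<in> carrier R \<Longrightarrow> (x, y) [^]\<^bsub>plane_group\<^esub> (k::nat) = ([k] \<cdot>\<^bsub>R\<^esub> x, [k] \<cdot>\<^bsub>R\<^esub> y)"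
proof (induct k)
  case (Suc k)
  then show ?case by (simp add: add_pow_def nat_pow_def)
qed (simp add: nat_pow_def)

text \<open>The generators are the elements \<open>\<pi> [^] i \<otimes> e\<close>, with
  \<open>i < m\<close> and \<open>e\<close> from \<open>es\<close>, placed in either coordinate; the
  bounds for their orders multiply to the order of the plane.\<close>

lemma cyclic_decomposition_plane:
  fixes p d m a b :: nat
  assumes prime: "Factorial_Ring.prime p" and m: "0 < m" and n: "n = a * m + b" and b: "b < m"
    and order: "order R = p ^ (d * n)" and index: "order R \<le> p ^ d * card (P 1)"
    and u: "u \<in> Units R" and p: "[p] \<cdot>\<^bsub>R\<^esub> \<one> = \<pi> [^] m \<otimes> u"
  obtains gs where "cyclic_decomposition plane_group gs
    (replicate (2 * d * b) (p ^ (a + 1)) @ replicate (2 * d * (m - b)) (p ^ a))"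
proof -
  have order_add: "order (add_monoid R) = order R" by (simp add: order_def)
  have "subgroup (P 1) (add_monoid R)" using P_ideal ideal.axioms(1) additive_subgroup.a_subgroup by blast
  then have "\<exists>es. length es = d \<and> set es \<subseteq> carrier (add_monoid R) \<and>
    (\<forall>S. subgroup S (add_monoid R) \<longrightarrow> P 1 \<subseteq> S \<longrightarrow> set es \<subseteq> S \<longrightarrow> S = carrier (add_monoid R))"
    using add.generators_over_subgroup[of p "d * n" "P 1" d] finite_carrier order index prime
    by (simp add: order_add)
  then obtain es where es: "length es = d" "set es \<subseteq> carrier R"
    and span: "\<And>S. subgroup S (add_monoid R) \<Longrightarrow> P 1 \<subseteq> S \<Longrightarrow> set es \<subseteq> S \<Longrightarrow> S = carrier R"
    by auto
  define L where "L is = map (\<lambda>(i, e). \<pi> [^] i \<otimes> e) (List.product is es)" for "is" :: "nat list"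
  define D where "D xs = map (\<lambda>x. (x, \<zero>)) xs @ map (\<lambda>x. (\<zero>, x)) xs" for xs :: "'a list"
  \<comment> \<open>Since \<open>n = a * m + b\<close>, the factor \<open>p ^ a\<close> kills
    \<open>\<pi> [^] i \<otimes> e\<close> for \<open>i \<ge> b\<close>, while for
    \<open>i < b\<close> one more factor \<open>p\<close> is used; hence the two side
    lengths.\<close>
  define A where "A = D (L [0..<b])"
  define B where "B = D (L [b..<m])"
  have lengths: "length A = 2 * d * b" "length B = 2 * d * (m - b)"
    using es by (simp_all add: A_def B_def D_def L_def)
  define ns where "ns = replicate (length A) (p ^ (a + 1)) @ replicate (length B) (p ^ a)"
  have set_L: "set (L is) = {\<pi> [^] i \<otimes> e | i e. i \<in> set is \<and> e \<in> set es}" for "is"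
    by (auto simp: L_def)
  have L_closed: "set (L is) \<subseteq> carrier R" for "is" using es by (auto simp: set_L)
  have set_D: "set (D xs) = (\<lambda>x. (x, \<zero>)) ` set xs \<union> (\<lambda>x. (\<zero>, x)) ` set xs" for xs
    by (simp add: D_def)
  have torsion_D: "g [^]\<^bsub>plane_group\<^esub> (p ^ c) = (\<zero>, \<zero>)"
    if g: "g \<in> set (D (L is))" and le: "\<And>i. i \<in> set is \<Longrightarrow> n \<le> c * m + i" for g c "is"
  proof -
    have "[(p ^ c)] \<cdot>\<^bsub>R\<^esub> x = \<zero>" if "x \<in> set (L is)" for x
      using that es le prime_power_torsion[OF u p] unfolding set_L by blast
    then show ?thesis using g L_closed[of "is"] unfolding set_D by (auto simp: pow_plane_group)
  qed
  have torsion_A: "g [^]\<^bsub>plane_group\<^esub> (p ^ (a + 1)) = (\<zero>, \<zero>)" if "g \<in> set A" for g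
    using torsion_D[of g "[0..<b]" "a + 1"] that n b by (simp add: A_def)
  have torsion_B: "g [^]\<^bsub>plane_group\<^esub> (p ^ a) = (\<zero>, \<zero>)" if "g \<in> set B" for g
    using torsion_D[of g "[b..<m]" "a"] that n b by (simp add: B_def)
  have gens: "(\<pi> [^] i \<otimes> e, \<zero>) \<in> set (A @ B)" "(\<zero>, \<pi> [^] i \<otimes> e) \<in> set (A @ B)"
    if "i < m" "e \<in> set es" for i e
  proof -
    have "\<pi> [^] i \<otimes> e \<in> set (L [0..<b]) \<union> set (L [b..<m])" using that unfolding set_L by force
    then show "(\<pi> [^] i \<otimes> e, \<zero>) \<in> set (A @ B)" "(\<zero>, \<pi> [^] i \<otimes> e) \<in> set (A @ B)"
      unfolding A_def B_def set_append set_D by blast+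
  qed
  have "cyclic_decomposition plane_group (A @ B) ns"
  proof (intro cyclic_decomposition.intro comm_group_plane cyclic_decomposition_axioms.intro)
    show "finite (carrier plane_group)" using finite_carrier by simp
    show "set (A @ B) \<subseteq> carrier plane_group"
      using L_closed unfolding A_def B_def set_append set_D by fastforce
    show "length (A @ B) = length ns" by (simp add: ns_def)
    show "0 < ns ! j" if "j < length ns" for j
      using that prime_gt_0_nat[OF prime] by (simp add: ns_def nth_append)
    show "(A @ B) ! j [^]\<^bsub>plane_group\<^esub> (ns ! j) = \<one>\<^bsub>plane_group\<^esub>" if j: "j < length ns" for j
    proof (cases "j < length A")
      case True
      then show ?thesis using torsion_A[of "A ! j"] by (simp add: ns_def nth_append)
    next
      case False
      then have "j - length A < length B" using j by (simp add: ns_def)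
      then show ?thesis using False torsion_B[of "B ! (j - length A)"] by (simp add: ns_def nth_append)
    qed
    show "order plane_group = prod_list ns"
    proof -
      have "order plane_group = order R * order R" by (simp add: order_def card_cartesian_product)
      also have "\<dots> = p ^ (2 * (d * n))" by (simp add: order power_add[symmetric] mult_2)
      also have "2 * (d * n) = (a + 1) * (2 * d * b) + a * (2 * d * (m - b))"
      proof -
        have "a * (2 * d * m) = a * (2 * d * b) + a * (2 * d * (m - b))"
          using b by (simp add: distrib_left[symmetric])
        then show ?thesis by (simp add: n algebra_simps)
      qed
      also have "p ^ \<dots> = (p ^ (a + 1)) ^ (2 * d * b) * (p ^ a) ^ (2 * d * (m - b))"
        by (simp only: power_add power_mult)
      also have "\<dots> = prod_list ns" by (simp add: ns_def lengths)
      finally show ?thesis .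
    qed
    show "S = carrier plane_group" if S: "subgroup S plane_group" and gen: "set (A @ B) \<subseteq> S" for S
    proof -
      have mult: "padd x y \<in> S" if "x \<in> S" "y \<in> S" for x y
        using subgroup.m_closed[OF S that] by (simp add: mult_plane_group)
      have one: "(\<zero>, \<zero>) \<in> S" using subgroup.one_closed[OF S] by simp
      have inv: "(\<ominus> x, \<ominus> y) \<in> S" if "(x, y) \<in> S" "x \<in> carrier R" "y \<in> carrier R" for x y
      proof -
        have "inv\<^bsub>plane_group\<^esub> (x, y) \<in> S" using subgroup.m_inv_closed[OF S that(1)] .
        then show ?thesis using that inv_DirProd[OF add.is_group add.is_group, of x y] by (simp add: a_inv_def)
      qed
      \<comment> \<open>Each coordinate axis is treated by itself: the part of it lying in
        \<open>S\<close> is a subgroup to which \<open>additive_generation\<close> applies.\<close>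
      have "{x \<in> carrier R. (x, \<zero>) \<in> S} = carrier R"
      proof (rule additive_generation[OF m u p es(2) span])
        show "subgroup {x \<in> carrier R. (x, \<zero>) \<in> S} (add_monoid R)"
        proof (rule add.subgroupI)
          show "{x \<in> carrier R. (x, \<zero>) \<in> S} \<noteq> {}" using one by blast
          show "\<ominus> x \<in> {x \<in> carrier R. (x, \<zero>) \<in> S}" if "x \<in> {x \<in> carrier R. (x, \<zero>) \<in> S}" for x
            using that inv[of x \<zero>] by simp
          show "x \<oplus> y \<in> {x \<in> carrier R. (x, \<zero>) \<in> S}"
            if "x \<in> {x \<in> carrier R. (x, \<zero>) \<in> S}" "y \<in> {x \<in> carrier R. (x, \<zero>) \<in> S}" for x y
            using that mult[of "(x, \<zero>)" "(y, \<zero>)"] by (simp add: padd_def)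
        qed auto
        show "\<pi> [^] i \<otimes> e \<in> {x \<in> carrier R. (x, \<zero>) \<in> S}" if "i < m" "e \<in> set es" for i e
          using gens[OF that] gen es that by auto
      qed
      moreover have "{x \<in> carrier R. (\<zero>, x) \<in> S} = carrier R"
      proof (rule additive_generation[OF m u p es(2) span])
        show "subgroup {x \<in> carrier R. (\<zero>, x) \<in> S} (add_monoid R)"
        proof (rule add.subgroupI)
          show "{x \<in> carrier R. (\<zero>, x) \<in> S} \<noteq> {}" using one by blast
          show "\<ominus> x \<in> {x \<in> carrier R. (\<zero>, x) \<in> S}" if "x \<in> {x \<in> carrier R. (\<zero>, x) \<in> S}" for x
            using that inv[of \<zero> x] by simp
          show "x \<oplus> y \<in> {x \<in> carrier R. (\<zero>, x) \<in> S}"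
            if "x \<in> {x \<in> carrier R. (\<zero>, x) \<in> S}" "y \<in> {x \<in> carrier R. (\<zero>, x) \<in> S}" for x y
            using that mult[of "(\<zero>, x)" "(\<zero>, y)"] by (simp add: padd_def)
        qed auto
        show "\<pi> [^] i \<otimes> e \<in> {x \<in> carrier R. (\<zero>, x) \<in> S}" if "i < m" "e \<in> set es" for i e
          using gens[OF that] gen es that by auto
      qed
      ultimately have axes: "(x, \<zero>) \<in> S" "(\<zero>, x) \<in> S" if "x \<in> carrier R" for x
        using that by blast+
      have "(x, y) \<in> S" if "x \<in> carrier R" "y \<in> carrier R" for x y
        using mult[OF axes(1)[OF that(1)] axes(2)[OF that(2)]] that by (simp add: padd_def)
      then show ?thesis using subgroup.subset[OF S] by auto
    qed
  qed
  then show ?thesis using that by (simp add: ns_def lengths)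
qed

end

section \<open>Self-dual functions and perfect arrays\<close>

text \<open>The element \<open>\<sigma>\<close> witnesses that \<open>\<chi>\<close> is nontrivial
  on the socle, hence on every nonzero ideal.\<close>

locale chain_ring_character = finite_chain_ring +
  fixes \<chi> :: "'a \<Rightarrow> complex" and \<sigma> :: 'a
  assumes char_add: "x \<in> carrier R \<Longrightarrow> y \<in> carrier R \<Longrightarrow> \<chi> (x \<oplus> y) = \<chi> x * \<chi> y"
    and char_norm: "x \<in> carrier R \<Longrightarrow> norm (\<chi> x) = 1"
    and socle: "\<sigma> \<in> P (n - 1)"
    and char_socle: "\<chi> \<sigma> \<noteq> 1"
begin

section \<open>Character sums over submodules of the plane\<close>

lemma char_zero [simp]: "\<chi> \<zero> = 1"
proof -
  have "\<chi> \<zero> * 1 = \<chi> \<zero> * \<chi> \<zero>" using char_add[of \<zero> \<zero>] by simp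
  moreover have "\<chi> \<zero> \<noteq> 0" using char_norm[of \<zero>] by auto
  ultimately show ?thesis by simp
qed

lemma char_minus: "x \<in> carrier R \<Longrightarrow> \<chi> (\<ominus> x) = cnj (\<chi> x)"
proof -
  assume x: "x \<in> carrier R"
  have "\<chi> x * \<chi> (\<ominus> x) = 1" using char_add[of x "\<ominus> x"] x by (simp add: r_neg)
  moreover have "\<chi> x * cnj (\<chi> x) = 1" using char_norm[OF x] by (simp add: complex_norm_square[symmetric])
  ultimately show ?thesis by (metis mult_cancel_left mult_zero_left zero_neq_one)
qed

text \<open>Some multiple \<open>t\<close> of \<open>p\<close> satisfies
  \<open>symp t s = \<sigma>\<close>; translating by \<open>t\<close> multiplies the sum by
  \<open>\<chi> \<sigma>\<close>, which is not 1.\<close>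

lemma char_sum_zero:
  assumes L: "submodule2 L" and s: "s \<in> V" and p: "p \<in> L" "symp p s \<noteq> \<zero>"
  shows "(\<Sum>q \<in> L. \<chi> (symp q s)) = 0"
proof -
  have LV: "L \<subseteq> V" and add: "\<And>p q. p \<in> L \<Longrightarrow> q \<in> L \<Longrightarrow> padd p q \<in> L"
    and smult: "\<And>c p. c \<in> carrier R \<Longrightarrow> p \<in> L \<Longrightarrow> (c \<otimes> fst p, c \<otimes> snd p) \<in> L"
    using L by (auto simp: submodule2_def)
  have pV: "p \<in> V" using p LV by auto
  obtain c where c: "c \<in> carrier R" "\<sigma> = c \<otimes> symp p s"
    using socle_multiple[OF symp_closed[OF pV s] p(2) socle] .
  define t where "t = (c \<otimes> fst p, c \<otimes> snd p)"
  have t: "t \<in> L" using smult[OF c(1) p(1)] by (simp add: t_def)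
  then have tV: "t \<in> V" using LV by blast
  have ts: "symp t s = \<sigma>" using symp_smult[OF pV s c(1)] c by (simp add: t_def)
  have "bij_betw (padd t) L L" unfolding bij_betw_def
  proof
    show inj: "inj_on (padd t) L" using padd_right_cancel[OF _ _ tV] LV by (meson inj_onI subsetD)
    have "padd t ` L \<subseteq> L" using add t by blast
    then show "padd t ` L = L" using inj finite_subset[OF LV finite_V] by (simp add: endo_inj_surj)
  qed
  then have "(\<Sum>q \<in> L. \<chi> (symp q s)) = (\<Sum>q \<in> L. \<chi> (symp (padd t q) s))"
    by (rule sum.reindex_bij_betw[symmetric])
  also have "\<dots> = (\<Sum>q \<in> L. \<chi> \<sigma> * \<chi> (symp q s))"
  proof (rule sum.cong[OF refl])
    fix q assume "q \<in> L"
    then have "q \<in> V" using LV by auto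
    then show "\<chi> (symp (padd t q) s) = \<chi> \<sigma> * \<chi> (symp q s)"
      using symp_padd_left[OF tV _ s, of q] ts char_add[of \<sigma> "symp q s"] s symp_closed[OF tV s] symp_closed[of q s] by simp
  qed
  also have "\<dots> = \<chi> \<sigma> * (\<Sum>q \<in> L. \<chi> (symp q s))" by (simp add: sum_distrib_left)
  finally show ?thesis using char_socle by simp
qed

lemma submodule2_V: "submodule2 V"
  by (auto simp: submodule2_def padd_def V_def)

lemma symp_nondegenerate:
  assumes "s \<in> V" "s \<noteq> (\<zero>, \<zero>)"
  obtains p where "p \<in> V" "symp p s \<noteq> \<zero>"
proof (cases "snd s = \<zero>")
  case True
  then have "symp (\<zero>, \<one>) s \<noteq> \<zero>" using assms by (cases s) (auto simp: symp_def minus_eq neg_eq_zero_iff)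
  then show ?thesis using that[of "(\<zero>, \<one>)"] by simp
next
  case False
  then have "symp (\<one>, \<zero>) s \<noteq> \<zero>" using assms by (cases s) (auto simp: symp_def minus_eq)
  then show ?thesis using that[of "(\<one>, \<zero>)"] by simp
qed

lemma char_sum_V: "s \<in> V \<Longrightarrow> s \<noteq> (\<zero>, \<zero>) \<Longrightarrow> (\<Sum>q \<in> V. \<chi> (symp q s)) = 0"
  using char_sum_zero[OF submodule2_V] symp_nondegenerate by metis

lemma char_commute: "p \<in> V \<Longrightarrow> s \<in> V \<Longrightarrow> \<chi> (symp s p) = cnj (\<chi> (symp p s))"
  using symp_commute[of p s] char_minus[of "symp p s"] symp_closed[of p s] by simp

lemma char_sum_self_dual:
  assumes "self_dual L" "s \<in> V"
  shows "(\<Sum>q \<in> L. \<chi> (symp q s)) = (if s \<in> L then of_nat (card L) else 0)"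
proof (cases "s \<in> L")
  case True
  then have "\<forall>q \<in> L. symp q s = \<zero>" using assms by (auto simp: self_dual_def)
  then show ?thesis using True by simp
next
  case False
  then obtain p where "p \<in> L" "symp p s \<noteq> \<zero>" using assms by (auto simp: self_dual_def)
  then show ?thesis using False char_sum_zero[of L s p] assms by (auto simp: self_dual_def)
qed

text \<open>Double counting of \<open>\<chi> (symp q s)\<close> over \<open>q \<in> L\<close> and
  \<open>s \<in> V\<close>: summing over \<open>q\<close> first gives the square of
  \<open>card L\<close>, summing over \<open>s\<close> first gives \<open>card V\<close>.\<close>

lemma card_self_dual:
  assumes "self_dual L"
  shows "card L = card (carrier R)"
proof -
  have LV: "L \<subseteq> V" using assms by (auto simp: self_dual_def submodule2_def)
  have "symp p (\<zero>, \<zero>) = \<zero>" if "p \<in> L" for p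
    using that LV by (auto simp: V_def symp_def minus_eq)
  then have z: "(\<zero>, \<zero>) \<in> L" using assms by (simp add: self_dual_def)
  have fL: "finite L" using finite_subset[OF LV finite_V] .
  have "of_nat (card L * card L) = (\<Sum>s \<in> V. if s \<in> L then of_nat (card L) else (0::complex))"
    using sum.inter_restrict[OF finite_V, of "\<lambda>_. of_nat (card L) :: complex" L] LV
    by (simp add: Int_absorb1)
  also have "\<dots> = (\<Sum>s \<in> V. \<Sum>q \<in> L. \<chi> (symp q s))"
    using char_sum_self_dual[OF assms] by simp
  also have "\<dots> = (\<Sum>q \<in> L. \<Sum>s \<in> V. \<chi> (symp q s))" by (rule sum.swap)
  also have "\<dots> = (\<Sum>q \<in> L. if q = (\<zero>, \<zero>) then of_nat (card V) else 0)"
  proof (rule sum.cong[OF refl])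
    fix q assume "q \<in> L"
    then have q: "q \<in> V" using LV by auto
    have "(\<Sum>s \<in> V. \<chi> (symp q s)) = (\<Sum>s \<in> V. cnj (\<chi> (symp s q)))"
      by (intro sum.cong refl char_commute q)
    then have eq: "(\<Sum>s \<in> V. \<chi> (symp q s)) = cnj (\<Sum>s \<in> V. \<chi> (symp s q))" by simp
    show "(\<Sum>s \<in> V. \<chi> (symp q s)) = (if q = (\<zero>, \<zero>) then of_nat (card V) else 0)"
    proof (cases "q = (\<zero>, \<zero>)")
      case True
      then have "\<forall>s \<in> V. symp q s = \<zero>" by (auto simp: V_iff symp_def minus_eq)
      then show ?thesis using True by simp
    next
      case False
      then show ?thesis using eq char_sum_V[OF q] by simp
    qed
  qed
  also have "\<dots> = of_nat (card V)" using z fL by simp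
  finally have "card L * card L = card V" using of_nat_eq_iff by blast
  then have "card L ^ 2 = card (carrier R) ^ 2" by (simp add: V_def card_cartesian_product power2_eq_square)
  then show ?thesis by simp
qed

text \<open>The functions fixed by the symplectic Fourier transform with normalising factor the
  inverse of \<open>card (carrier R)\<close>; they form a complex vector space.\<close>

definition dual_fun :: "('a \<times> 'a \<Rightarrow> complex) \<Rightarrow> bool" where
  "dual_fun F \<longleftrightarrow> (\<forall>s \<in> V. (\<Sum>p \<in> V. F p * \<chi> (symp p s)) = of_nat (card (carrier R)) * F s)"

text \<open>The character sum over \<open>L\<close> is \<open>card L\<close> times the indicator
  function, and \<open>card_self_dual\<close> identifies this factor.\<close>

lemma dual_fun_indicator:
  assumes "self_dual L"
  shows "dual_fun (\<lambda>p. of_bool (p \<in> L))"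
  unfolding dual_fun_def
proof
  fix s assume s: "s \<in> V"
  have LV: "L \<subseteq> V" using assms by (auto simp: self_dual_def submodule2_def)
  have "(\<Sum>p \<in> V. of_bool (p \<in> L) * \<chi> (symp p s)) = (\<Sum>p \<in> V. if p \<in> L then \<chi> (symp p s) else 0)"
    by (rule sum.cong) auto
  also have "\<dots> = (\<Sum>p \<in> L. \<chi> (symp p s))"
    using sum.inter_restrict[OF finite_V, of "\<lambda>p. \<chi> (symp p s)" L] LV by (simp add: Int_absorb1)
  finally show "(\<Sum>p \<in> V. of_bool (p \<in> L) * \<chi> (symp p s)) = of_nat (card (carrier R)) * of_bool (s \<in> L)"
    using char_sum_self_dual[OF assms s] card_self_dual[OF assms] by simp
qed

lemma dual_fun_sum:
  assumes "\<And>i. i \<in> A \<Longrightarrow> dual_fun (F i)"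
  shows "dual_fun (\<lambda>p. \<Sum>i \<in> A. F i p)"
  unfolding dual_fun_def
proof
  fix s assume s: "s \<in> V"
  have "(\<Sum>p \<in> V. (\<Sum>i \<in> A. F i p) * \<chi> (symp p s)) = (\<Sum>i \<in> A. \<Sum>p \<in> V. F i p * \<chi> (symp p s))"
    by (simp add: sum_distrib_right sum.swap[of _ V])
  then show "(\<Sum>p \<in> V. (\<Sum>i \<in> A. F i p) * \<chi> (symp p s)) = of_nat (card (carrier R)) * (\<Sum>i \<in> A. F i s)"
    using assms s by (simp add: dual_fun_def sum_distrib_left)
qed

lemma dual_fun_add: "dual_fun F \<Longrightarrow> dual_fun G \<Longrightarrow> dual_fun (\<lambda>p. F p + G p)"
  by (simp add: dual_fun_def distrib_right distrib_left sum.distrib)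

lemma dual_fun_scale: "dual_fun F \<Longrightarrow> dual_fun (\<lambda>p. c * F p)"
  by (simp add: dual_fun_def mult.assoc sum_distrib_left[symmetric] mult.left_commute)

text \<open>Self-duality is used twice, to expand the shifted factor and to evaluate the resulting
  sum over \<open>p\<close>. Unimodularity then cancels \<open>F q\<close> against its conjugate,
  and a nontrivial character sum over the plane remains.\<close>

lemma dual_fun_perfect:
  assumes F: "dual_fun F" and unimodular: "\<And>p. p \<in> V \<Longrightarrow> norm (F p) = 1"
    and s: "s \<in> V" "s \<noteq> (\<zero>, \<zero>)"
  shows "(\<Sum>p \<in> V. F p * cnj (F (padd p s))) = 0"
proof -
  define N where "N = (of_nat (card (carrier R)) :: complex)"
  have N: "N \<noteq> 0" "cnj N = N" using finite_carrier carrier_not_empty by (auto simp: N_def)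
  have hat: "(\<Sum>p \<in> V. F p * \<chi> (symp p s)) = N * F s" if "s \<in> V" for s
    using F that by (simp add: dual_fun_def N_def)
  \<comment> \<open>By antisymmetry of \<open>symp\<close>, conjugation turns the character of
    \<open>symp q p\<close> into that of \<open>symp p q\<close>, so that self-duality can be
    applied again in \<open>p\<close>.\<close>
  have conj: "N * cnj (F (padd p s)) = (\<Sum>q \<in> V. cnj (F q) * cnj (\<chi> (symp q s)) * \<chi> (symp p q))" if p: "p \<in> V" for p
  proof -
    have "N * cnj (F (padd p s)) = cnj (\<Sum>q \<in> V. F q * \<chi> (symp q (padd p s)))"
      using hat[of "padd p s"] p s by (simp add: N del: cnj_sum)
    also have "\<dots> = (\<Sum>q \<in> V. cnj (F q) * cnj (\<chi> (symp q (padd p s))))" by simp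
    also have "\<dots> = (\<Sum>q \<in> V. cnj (F q) * cnj (\<chi> (symp q s)) * \<chi> (symp p q))"
    proof (rule sum.cong[OF refl])
      fix q assume q: "q \<in> V"
      show "cnj (F q) * cnj (\<chi> (symp q (padd p s))) = cnj (F q) * cnj (\<chi> (symp q s)) * \<chi> (symp p q)"
        using symp_padd_right[OF p s(1) q] char_add[OF symp_closed[OF q p] symp_closed[OF q s(1)]]
          char_commute[OF q p] by simp
    qed
    finally show ?thesis .
  qed
  have "N * (\<Sum>p \<in> V. F p * cnj (F (padd p s))) = (\<Sum>p \<in> V. F p * (N * cnj (F (padd p s))))"
    by (simp add: sum_distrib_left mult.left_commute)
  also have "\<dots> = (\<Sum>p \<in> V. F p * (\<Sum>q \<in> V. cnj (F q) * cnj (\<chi> (symp q s)) * \<chi> (symp p q)))"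
    using conj by simp
  also have "\<dots> = (\<Sum>p \<in> V. \<Sum>q \<in> V. cnj (F q) * cnj (\<chi> (symp q s)) * (F p * \<chi> (symp p q)))"
    by (simp add: sum_distrib_left mult_ac)
  also have "\<dots> = (\<Sum>q \<in> V. cnj (F q) * cnj (\<chi> (symp q s)) * (\<Sum>p \<in> V. F p * \<chi> (symp p q)))"
    by (subst sum.swap) (simp add: sum_distrib_left)
  also have "\<dots> = (\<Sum>q \<in> V. N * cnj (\<chi> (symp q s)))"
  proof (rule sum.cong[OF refl])
    fix q assume q: "q \<in> V"
    have "F q * cnj (F q) = 1" using unimodular[OF q] by (simp add: complex_norm_square[symmetric])
    then show "cnj (F q) * cnj (\<chi> (symp q s)) * (\<Sum>p \<in> V. F p * \<chi> (symp p q)) = N * cnj (\<chi> (symp q s))"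
      using hat[OF q] by (simp add: mult_ac)
  qed
  also have "\<dots> = N * cnj (\<Sum>q \<in> V. \<chi> (symp q s))" by (simp add: sum_distrib_left)
  also have "\<dots> = 0" using char_sum_V[OF s] by simp
  finally show ?thesis using N by simp
qed

section \<open>Unimodular self-dual functions under (i) and (ii)\<close>

lemma dual_fun_leaf: "k \<le> n \<Longrightarrow> r \<in> carrier R \<Longrightarrow> dual_fun (\<lambda>p. of_bool (p \<in> leaf k r))"
  by (intro dual_fun_indicator self_dual_leaf)

lemma dual_fun_leaf_swap:
  assumes "k \<le> n" "r \<in> carrier R"
  shows "dual_fun (\<lambda>p. of_bool (prod.swap p \<in> leaf k r))"
proof -
  have "p \<in> prod.swap ` leaf k r \<longleftrightarrow> prod.swap p \<in> leaf k r" for p by (metis image_iff swap_swap)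
  then show ?thesis using dual_fun_indicator[OF self_dual_swap[OF self_dual_leaf[OF assms]]] by simp
qed

lemma spread_dual_fun:
  fixes \<epsilon> \<mu> :: "'a \<Rightarrow> complex"
  assumes "\<And>i r. 1 \<le> i \<Longrightarrow> i \<le> n \<Longrightarrow> r \<in> carrier R \<Longrightarrow> (\<Sum>r' \<in> {r' \<in> carrier R. r \<ominus> r' \<in> P i}. \<epsilon> r') ^ h = 1"
    and "\<And>i s. 1 \<le> i \<Longrightarrow> i \<le> n \<Longrightarrow> s \<in> P 1 \<Longrightarrow> (\<Sum>s' \<in> {s' \<in> P 1. s \<ominus> s' \<in> P i}. \<mu> s') ^ h = 1"
    and "((\<Sum>r \<in> carrier R. \<epsilon> r) + (\<Sum>s \<in> P 1. \<mu> s)) ^ h = 1"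
  shows "\<exists>F. dual_fun F \<and> (\<forall>p \<in> V. F p ^ h = 1)"
proof (intro exI conjI ballI)
  let ?F = "\<lambda>p. (\<Sum>r \<in> carrier R. \<epsilon> r * of_bool (p \<in> leaf 0 r)) + (\<Sum>s \<in> P 1. \<mu> s * of_bool (prod.swap p \<in> leaf 0 s))"
  show "dual_fun ?F"
    by (intro dual_fun_add dual_fun_sum dual_fun_scale dual_fun_leaf dual_fun_leaf_swap) auto
  fix p assume "p \<in> V"
  then show "?F p ^ h = 1" using unimodular_spread_sum[OF assms, of "fst p" "snd p"] by (cases p) auto
qed

lemma balanced_dual_fun:
  fixes E :: "'a \<Rightarrow> complex"
  assumes "\<And>r. r \<in> carrier R \<Longrightarrow> E r ^ h = 1"
    and "\<And>r r'. r \<in> carrier R \<Longrightarrow> r' \<in> carrier R \<Longrightarrow> r \<ominus> r' \<in> P 1 \<Longrightarrow> E r = E r'"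
    and "(\<Sum>r \<in> carrier R. E r) = 0"
  shows "\<exists>F. dual_fun F \<and> (\<forall>p \<in> V. F p ^ h = 1)"
proof -
  \<comment> \<open>The condition for a single level, so that the functions can be chosen level by
    level.\<close>
  define Q where "Q k g \<longleftrightarrow> (2 * k < n \<longrightarrow> (\<forall>r \<in> carrier R. g r ^ h = 1 \<and>
     (\<forall>r' \<in> carrier R. r \<ominus> r' \<in> P (n - 2 * k) \<longrightarrow> g r = g r') \<and>
     (\<Sum>t \<in> carrier R. g (r \<oplus> \<pi> [^] (n - 2 * k - 1) \<otimes> t)) = (0::complex)))" for k g
  have "\<exists>g. Q k g" for k
  proof (cases "2 * k < n")
    case True
    \<comment> \<open>\<open>E\<close> is applied to the last digit of a slope modulo
      \<open>P (n - 2 * k)\<close>.\<close>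
    then have l: "n - 2 * k - 1 < n" "n - 2 * k - 1 + 1 = n - 2 * k" by auto
    then show ?thesis using lift_balanced[where E = E and h = h, OF assms l(1)] unfolding Q_def l(2) by blast
  qed (simp add: Q_def)
  then obtain g where "\<And>k. Q k (g k)" by metis
  then have g: "balanced_family h g" unfolding balanced_family_def Q_def by blast
  let ?F = "\<lambda>p. balanced_sum g 0 p + balanced_sum g 1 (prod.swap p) + of_bool (prod.swap p \<in> leaf (n div 2) \<zero>)"
  show ?thesis
  proof (intro exI conjI ballI)
    show "dual_fun ?F" unfolding balanced_sum_def
      by (intro dual_fun_add dual_fun_sum dual_fun_scale dual_fun_leaf dual_fun_leaf_swap) auto
    fix p assume "p \<in> V"
    then have "fst p \<in> carrier R" "snd p \<in> carrier R" by (simp_all add: V_iff)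
    from unimodular_balanced_sum[OF this g] show "?F p ^ h = 1"
      by (simp add: prod.swap_def)
  qed
qed

end

section \<open>Construction of the perfect array\<close>

theorem theorem4p10:
  fixes R :: "('a, 'b) ring_scheme"
    and I R1 :: "'a set"
    and \<pi> u :: 'a
    and p d m n a b h :: nat
  assumes "Factorial_Ring.prime p" and "0 < d" and "0 < m" and "0 < n"
    and "n = a * m + b" and "b < m"
    and "local_ring R" and "finite (carrier R)" and "order R = p ^ (d * n)"
    and "maximalideal I R"
    and "\<pi> \<in> carrier R" and "I = Idl\<^bsub>R\<^esub> {\<pi>}"
    and "\<pi> [^]\<^bsub>R\<^esub> (n - 1) \<noteq> \<zero>\<^bsub>R\<^esub>" and "\<pi> [^]\<^bsub>R\<^esub> n = \<zero>\<^bsub>R\<^esub>"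
    and "u \<in> Units R" and "[p] \<cdot>\<^bsub>R\<^esub> \<one>\<^bsub>R\<^esub> = \<pi> [^]\<^bsub>R\<^esub> m \<otimes>\<^bsub>R\<^esub> u"
    and "field (R Quot I)" and "order (R Quot I) = p ^ d"
    and "coset_representatives R I R1" and "\<zero>\<^bsub>R\<^esub> \<in> R1"
    and "0 < h"
    and "(\<exists>c :: nat \<Rightarrow> nat. p ^ d = (\<Sum>q \<in> prime_factors h. q * c q)) \<or>
         (\<exists>\<eta> \<epsilon> \<delta> \<mu> \<gamma>. root_system R I \<pi> R1 n h \<eta> \<epsilon> \<delta> \<mu> \<gamma>)"
  shows "\<exists>A. perfect_phase_array h
           (replicate (2 * d * b) (p ^ (a + 1)) @ replicate (2 * d * (m - b)) (p ^ a)) A"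
proof -
  interpret R: cring R using assms(7) by (simp add: local_ring_def)
  have I_eq: "I = PIdl\<^bsub>R\<^esub> \<pi>" using R.cgenideal_eq_genideal[OF assms(11)] assms(12) by simp
  interpret finite_chain_ring R \<pi> n
  proof (unfold_locales)
    fix x assume x: "x \<in> carrier R" "x \<notin> PIdl\<^bsub>R\<^esub> \<pi>"
    interpret I: maximalideal I R by fact
    \<comment> \<open>\<open>J\<close> is the ideal generated by \<open>I\<close> and
      \<open>x\<close>; by maximality it is the whole ring, so \<open>x\<close> is invertible modulo
      \<open>I\<close>.\<close>
    define J where "J = {i \<oplus>\<^bsub>R\<^esub> r \<otimes>\<^bsub>R\<^esub> x | i r. i \<in> I \<and> r \<in> carrier R}"
    have J: "J = I <+>\<^bsub>R\<^esub> PIdl\<^bsub>R\<^esub> x" unfolding J_def set_add_def' cgenideal_def by auto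
    have "ideal J R" unfolding J using R.cgenideal_ideal[OF x(1)] by (intro R.add_ideals I.is_ideal)
    moreover have "I \<subseteq> J"
    proof
      fix i assume i: "i \<in> I"
      then have "i = i \<oplus>\<^bsub>R\<^esub> \<zero>\<^bsub>R\<^esub> \<otimes>\<^bsub>R\<^esub> x" using x I.Icarr by simp
      then show "i \<in> J" unfolding J_def using i by blast
    qed
    moreover have "x \<in> J"
    proof -
      have "x = \<zero>\<^bsub>R\<^esub> \<oplus>\<^bsub>R\<^esub> \<one>\<^bsub>R\<^esub> \<otimes>\<^bsub>R\<^esub> x" using x by simp
      then show ?thesis unfolding J_def using I.zero_closed by blast
    qed
    ultimately have "J = carrier R"
      using I.I_maximal[of J] x I_eq ideal.Icarr[of J R] by blast
    then have "\<one>\<^bsub>R\<^esub> \<in> J" by simp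
    then obtain i r where ir: "i \<in> I" "r \<in> carrier R" "\<one>\<^bsub>R\<^esub> = i \<oplus>\<^bsub>R\<^esub> r \<otimes>\<^bsub>R\<^esub> x"
      unfolding J_def by blast
    obtain z where z: "z \<in> carrier R" "i = z \<otimes>\<^bsub>R\<^esub> \<pi>" using ir I_eq unfolding cgenideal_def by blast
    have iR: "i \<in> carrier R" using z assms(11) by simp
    \<comment> \<open>\<open>x\<close> is invertible modulo the nilpotent ideal \<open>I\<close>, hence not a zero divisor.\<close>
    have mult_injective: "y = \<zero>\<^bsub>R\<^esub>" if y: "y \<in> carrier R" "x \<otimes>\<^bsub>R\<^esub> y = \<zero>\<^bsub>R\<^esub>" for y
    proof -
      have "y = (i \<oplus>\<^bsub>R\<^esub> r \<otimes>\<^bsub>R\<^esub> x) \<otimes>\<^bsub>R\<^esub> y" using ir y by (simp flip: ir(3))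
      also have "\<dots> = i \<otimes>\<^bsub>R\<^esub> y" using iR ir(1,2) x y by (simp add: R.l_distr R.m_assoc)
      finally have iy: "y = i \<otimes>\<^bsub>R\<^esub> y" .
      have "y = i [^]\<^bsub>R\<^esub> k \<otimes>\<^bsub>R\<^esub> y" for k :: nat
      proof (induct k)
        case (Suc k)
        have "i [^]\<^bsub>R\<^esub> Suc k \<otimes>\<^bsub>R\<^esub> y = i [^]\<^bsub>R\<^esub> k \<otimes>\<^bsub>R\<^esub> (i \<otimes>\<^bsub>R\<^esub> y)" using iR y by (simp add: R.m_assoc)
        then show ?case using Suc iy by simp
      qed (use y in simp)
      from this[of n] show ?thesis using z y assms(11,14) by (simp add: R.nat_pow_distrib)
    qed
    \<comment> \<open>An injective self-map of the finite ring is surjective, so some multiple of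
      \<open>x\<close> is one.\<close>
    have "inj_on (\<lambda>y. x \<otimes>\<^bsub>R\<^esub> y) (carrier R)"
    proof (rule inj_onI)
      fix y y' assume y: "y \<in> carrier R" "y' \<in> carrier R" "x \<otimes>\<^bsub>R\<^esub> y = x \<otimes>\<^bsub>R\<^esub> y'"
      then have "x \<otimes>\<^bsub>R\<^esub> (y \<ominus>\<^bsub>R\<^esub> y') = \<zero>\<^bsub>R\<^esub>"
        using x by (simp add: R.minus_eq R.r_distr R.r_minus R.r_neg)
      then have "y \<ominus>\<^bsub>R\<^esub> y' = \<zero>\<^bsub>R\<^esub>" using mult_injective y by simp
      then show "y = y'" using y by simp
    qed
    moreover have "(\<lambda>y. x \<otimes>\<^bsub>R\<^esub> y) ` carrier R \<subseteq> carrier R" using x by auto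
    ultimately have "(\<lambda>y. x \<otimes>\<^bsub>R\<^esub> y) ` carrier R = carrier R"
      using endo_inj_surj[OF assms(8)] by blast
    then obtain y where "y \<in> carrier R" "\<one>\<^bsub>R\<^esub> = x \<otimes>\<^bsub>R\<^esub> y" using R.one_closed by blast
    then show "x \<in> Units R" using x R.m_comm unfolding Units_def by auto
  qed (use assms in auto)
  have I: "I = P 1" by (simp only: I_eq P_1)
  have cosets: "card (a_rcosets\<^bsub>R\<^esub> (P 1)) = p ^ d"
    using assms(18) by (simp add: order_def FactRing_def I)
  have "subgroup (P 1) (add_monoid R)" using P_ideal ideal.axioms(1) additive_subgroup.a_subgroup by blast
  then have "p ^ d * card (P 1) = order R"
    using R.add.lagrange[of "P 1"] cosets by (simp add: A_RCOSETS_def order_def)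
  then obtain gs where "cyclic_decomposition plane_group gs
    (replicate (2 * d * b) (p ^ (a + 1)) @ replicate (2 * d * (m - b)) (p ^ a))"
    using cyclic_decomposition_plane[OF assms(1,3,5,6,9) _ assms(15,16)] by (metis le_refl)
  then interpret G: cyclic_decomposition plane_group gs
    "replicate (2 * d * b) (p ^ (a + 1)) @ replicate (2 * d * (m - b)) (p ^ a)" .
  \<comment> \<open>The character is taken on the plane, where the cyclic decomposition lives, and
    restricted to the first coordinate; being nontrivial at this vector, it is nontrivial on the
    socle.\<close>
  have "(\<pi> [^]\<^bsub>R\<^esub> (n - 1), \<zero>\<^bsub>R\<^esub>) \<noteq> \<one>\<^bsub>plane_group\<^esub>" using assms(13) by simp
  moreover have "(\<pi> [^]\<^bsub>R\<^esub> (n - 1), \<zero>\<^bsub>R\<^esub>) \<in> carrier plane_group" using assms(11) by simp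
  ultimately obtain \<psi> :: "'a \<times> 'a \<Rightarrow> complex" where \<psi>:
    "\<forall>x \<in> carrier plane_group. \<forall>y \<in> carrier plane_group. \<psi> (x \<otimes>\<^bsub>plane_group\<^esub> y) = \<psi> x * \<psi> y"
    "\<forall>x. norm (\<psi> x) = 1" "\<psi> (\<pi> [^]\<^bsub>R\<^esub> (n - 1), \<zero>\<^bsub>R\<^esub>) \<noteq> 1"
    using G.nontrivial_character by blast
  interpret chain_ring_character R \<pi> n "\<lambda>x. \<psi> (x, \<zero>\<^bsub>R\<^esub>)" "\<pi> [^]\<^bsub>R\<^esub> (n - 1)"
  proof (unfold_locales)
    show "\<psi> (x \<oplus>\<^bsub>R\<^esub> y, \<zero>\<^bsub>R\<^esub>) = \<psi> (x, \<zero>\<^bsub>R\<^esub>) * \<psi> (y, \<zero>\<^bsub>R\<^esub>)" if "x \<in> carrier R" "y \<in> carrier R" for x y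
      using \<psi>(1)[rule_format, of "(x, \<zero>\<^bsub>R\<^esub>)" "(y, \<zero>\<^bsub>R\<^esub>)"] that by simp
    show "\<pi> [^]\<^bsub>R\<^esub> (n - 1) \<in> P (n - 1)" using P_I[of "\<one>\<^bsub>R\<^esub>" "n - 1"] assms(11) by simp
  qed (use \<psi> in auto)
  have "\<exists>F. dual_fun F \<and> (\<forall>p \<in> V. F p ^ h = 1)"
    using assms(22)
  proof
    assume "\<exists>c :: nat \<Rightarrow> nat. p ^ d = (\<Sum>q \<in> prime_factors h. q * c q)"
    then obtain c where "p ^ d = (\<Sum>q \<in> prime_factors h. q * c q)" by blast
    \<comment> \<open>There are as many roots of unity as elements of the residue field.\<close>
    then obtain f :: "nat \<Rightarrow> complex" where f: "\<And>i. f i ^ h = 1" "(\<Sum>i<p ^ d. f i) = 0"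
      using balanced_roots_of_unity[OF assms(21)] by blast
    obtain E :: "'a \<Rightarrow> complex" where "\<forall>r. E r ^ h = 1"
      "\<forall>r \<in> carrier R. \<forall>r' \<in> carrier R. r \<ominus>\<^bsub>R\<^esub> r' \<in> P 1 \<longrightarrow> E r = E r'" "(\<Sum>r \<in> carrier R. E r) = 0"
      using balanced_residue_function[OF cosets f] by blast
    then show ?thesis by (intro balanced_dual_fun[of E]) blast+
  next
    assume "\<exists>\<eta> \<epsilon> \<delta> \<mu> \<gamma>. root_system R I \<pi> R1 n h \<eta> \<epsilon> \<delta> \<mu> \<gamma>"
    then obtain \<eta> \<epsilon> \<delta> \<mu> \<gamma> where rs: "root_system R (P 1) \<pi> R1 n h \<eta> \<epsilon> \<delta> \<mu> \<gamma>" unfolding I by blast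
    show ?thesis
      by (rule spread_dual_fun[OF root_system_sums[OF assms(19)[unfolded I] assms(20) rs]])
  qed
  then obtain F where F: "dual_fun F" "\<And>p. p \<in> V \<Longrightarrow> F p ^ h = 1" by blast
  have norm: "norm (F p) = 1" if "p \<in> V" for p
    using F(2)[OF that] assms(21) by (metis norm_power norm_one power_eq_1_iff norm_ge_zero less_numeral_extra(3))
  have "perfect_phase_array h (replicate (2 * d * b) (p ^ (a + 1)) @ replicate (2 * d * (m - b)) (p ^ a))
    (\<lambda>is. F (G.elem is))"
  proof (rule G.perfect_array_of_function)
    show "F x ^ h = 1" if "x \<in> carrier plane_group" for x
      using F(2) that unfolding carrier_plane_group by blast
    show "(\<Sum>x \<in> carrier plane_group. F x * cnj (F (x \<otimes>\<^bsub>plane_group\<^esub> s))) = 0"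
      if "s \<in> carrier plane_group" "s \<noteq> \<one>\<^bsub>plane_group\<^esub>" for s
      using dual_fun_perfect[OF F(1) norm] that unfolding carrier_plane_group mult_plane_group one_plane_group by blast
  qed
  then show ?thesis by blast
qed

end
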